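(* Let $\mathcal{Y}$ be a category and let $\mathcal{A}=\Delta_+^{*}$ be the opposite of the augmented simplicial category. Regard $[\mathcal{A},\mathcal{Y}]$ as the $0$-cell of $\mathcal{A}\text{-}\mathbf{Mod}\text{-}\mathcal{A}$ corresponding to the identity distributive law $\mathrm{Dec}^{r}\,\mathrm{Dec}^{l}\Rightarrow\mathrm{Dec}^{l}\,\mathrm{Dec}^{r}$ between the décalage comonads. Then the category $\mathrm{H}^0(\mathcal{A},[\mathcal{A},\mathcal{Y}])$ is isomorphic to the category of augmented duplicial objects in $\mathcal{Y}$.
   Context: $\Delta_+$ is the category of ordinals $\mathbf{n}=\{0,\dots,n\}$ for $n\ge -1$ (with $\mathbf{-1}=\emptyset$) and order-preserving maps; it is strict monoidal under ordinal sum $\mathbf{m}\oplus\mathbf{n}=\mathbf{m+n+1}$ (on maps, $(f\oplus g)(i)=f(i)$ for $0\le i\le m$, and for $i>m$ it is $g(i-m-1)$ regarded in the second summand), with unit $\mathbf{-1}$. $\mathcal{A}=\Delta_+^*$ carries the induced strict monoidal structure. $[\mathcal{A},\mathcal{Y}]$ is the category of augmented simplicial objects in $\mathcal{Y}$. For an augmented simplicial object $X$, $\mathrm{Dec}^{r}(X)_n=X_{n+1}$ with the last face and degeneracy of $X$ discarded, and $\mathrm{Dec}^{l}(X)_n=X_{n+1}$ with the zeroth face and degeneracy discarded; each is a comonad with counit given by the discarded faces and comultiplication by the discarded degeneracies, and $\mathrm{Dec}^{r}\mathrm{Dec}^{l}=\mathrm{Dec}^{l}\mathrm{Dec}^{r}$.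 The $0$-cell structure on $[\mathcal{A},\mathcal{Y}]$: strict left and right actions of $\mathcal{A}$ given by $(\mathbf{m}\rhd X)(\mathbf{n})=X(\mathbf{n}\oplus\mathbf{m})$ and $(X\lhd\mathbf{m})(\mathbf{n})=X(\mathbf{m}\oplus\mathbf{n})$, so that $\mathbf{0}\rhd X=\mathrm{Dec}^{r}X$ and $X\lhd\mathbf{0}=\mathrm{Dec}^{l}X$, with compatibility $\chi\colon\mathbf{m}\rhd(X\lhd\mathbf{n})\to(\mathbf{m}\rhd X)\lhd\mathbf{n}$ the identity. For a category $\mathcal{M}$ with such actions of a strict monoidal category $(\mathcal{A},\otimes,I)$ and compatibility $\chi$, the category $\mathrm{H}^0(\mathcal{A},\mathcal{M})$ has as objects pairs $(M,\rho)$ with $M\in\mathcal{M}$ and $\rho_A\colon A\rhd M\to M\lhd A$ natural in $A$, such that $\rho_I=1$ and $\rho_{A\otimes B}$ is the composite $$(A\otimes B)\rhd M=A\rhd(B\rhd M)\xrightarrow{A\rhd\rho_B}A\rhd(M\lhd B)\xrightarrow{\chi}(A\rhd M)\lhd B\xrightarrow{\rho_A\lhd B}(M\lhd A)\lhd B=M\lhd(A\otimes B);$$ morphisms $f\colon(M,\rho)\to(M',\rho')$ are morphisms $f\colon M\to M'$ with $(f\lhd A)\circ\rho_A=\rho'_A\circ(A\rhd f)$ for all $A$. An augmented duplicial object in $\mathcal{Y}$ is an augmented simplicial object $X$ (faces $d_i\colon X_n\to X_{n-1}$ for $n\ge 0$, degeneracies $s_i\colon X_n\to X_{n+1}$, $0\le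 i\le n$) with morphisms $t\colon X_n\to X_n$ for all $n\ge 0$ such that, on $X_n$ with $n\ge 0$, $$d_it=\begin{cases} t d_{i-1} & 1\le i\le n\\ d_n & i=0\end{cases}\qquad s_jt=\begin{cases} t s_{j-1} & 1\le j\le n\\ t^2s_n & j=0.\end{cases}$$ Morphisms are morphisms of augmented simplicial objects commuting with the operators $t$. *)

theory Defs
  imports Main "HOL-Library.FuncSet"
begin

section \<open>Categories and functors\<close>

record ('o, 'm) category =
  Obj :: "'o set"
  Arr :: "'m set"
  Dom :: "'m \<Rightarrow> 'o"
  Cod :: "'m \<Rightarrow> 'o"
  Ide :: "'o \<Rightarrow> 'm"
  Comp :: "'m \<Rightarrow> 'm \<Rightarrow> 'm"  (infixr "\<cdot>\<index>" 70)

definition hom :: "('o, 'm, 'z) category_scheme \<Rightarrow> 'o \<Rightarrow> 'o \<Rightarrow> 'm set" where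
  "hom C A B = {f \<in> Arr C. Dom C f = A \<and> Cod C f = B}"

locale category =
  fixes C :: "('o, 'm, 'z) category_scheme" (structure)
  assumes Dom_in: "f \<in> Arr C \<Longrightarrow> Dom C f \<in> Obj C"
    and Cod_in: "f \<in> Arr C \<Longrightarrow> Cod C f \<in> Obj C"
    and Ide_in: "A \<in> Obj C \<Longrightarrow> Ide C A \<in> hom C A A"
    and Comp_in: "\<lbrakk>f \<in> hom C A B; g \<in> hom C B D\<rbrakk> \<Longrightarrow> g \<cdot> f \<in> hom C A D"
    and Comp_Ide: "f \<in> hom C A B \<Longrightarrow> f \<cdot> Ide C A = f"
    and Ide_Comp: "f \<in> hom C A B \<Longrightarrow> Ide C B \<cdot> f = f"
    and Comp_assoc: "\<lbrakk>f \<in> hom C A B; g \<in> hom C B D; h \<in> hom C D E\<rbrakk>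
      \<Longrightarrow> (h \<cdot> g) \<cdot> f = h \<cdot> (g \<cdot> f)"

text \<open>The object and arrow maps of a functor are required to be extensional, so that
  equality of these records is equality of functors.\<close>

record ('o, 'm, 'p, 'n) ftor =
  fobj :: "'o \<Rightarrow> 'p"
  farr :: "'m \<Rightarrow> 'n"

definition is_functor ::
  "('o, 'm, 'y) category_scheme \<Rightarrow> ('p, 'n, 'z) category_scheme \<Rightarrow> ('o, 'm, 'p, 'n) ftor \<Rightarrow> bool"
where
  "is_functor C D F \<longleftrightarrow>
     category C \<and> category D \<and>
     fobj F \<in> Obj C \<rightarrow>\<^sub>E Obj D \<and>
     farr F \<in> extensional (Arr C) \<and>
     (\<forall>A B f. f \<in> hom C A B \<longrightarrow> farr F f \<in> hom D (fobj F A) (fobj F B)) \<and>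
     (\<forall>A \<in> Obj C. farr F (Ide C A) = Ide D (fobj F A)) \<and>
     (\<forall>A B E f g. f \<in> hom C A B \<and> g \<in> hom C B E \<longrightarrow>
        farr F (g \<cdot>\<^bsub>C\<^esub> f) = farr F g \<cdot>\<^bsub>D\<^esub> farr F f)"

definition id_functor :: "('o, 'm, 'z) category_scheme \<Rightarrow> ('o, 'm, 'o, 'm) ftor" where
  "id_functor C = \<lparr>fobj = (\<lambda>A \<in> Obj C. A), farr = (\<lambda>f \<in> Arr C. f)\<rparr>"

definition comp_functor ::
  "('o, 'm, 'z) category_scheme \<Rightarrow> ('p, 'n, 'q, 'r) ftor \<Rightarrow> ('o, 'm, 'p, 'n) ftor \<Rightarrow> ('o, 'm, 'q, 'r) ftor"
where
  "comp_functor C G F =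
     \<lparr>fobj = (\<lambda>A \<in> Obj C. fobj G (fobj F A)), farr = (\<lambda>f \<in> Arr C. farr G (farr F f))\<rparr>"

definition isomorphic_categories ::
  "('o, 'm, 'y) category_scheme \<Rightarrow> ('p, 'n, 'z) category_scheme \<Rightarrow> bool"
where
  "isomorphic_categories C D \<longleftrightarrow>
     (\<exists>F G. is_functor C D F \<and> is_functor D C G \<and>
            comp_functor C G F = id_functor C \<and> comp_functor D F G = id_functor D)"

definition prod_cat ::
  "('o, 'm, 'y) category_scheme \<Rightarrow> ('p, 'n, 'z) category_scheme \<Rightarrow> ('o \<times> 'p, 'm \<times> 'n) category"
where
  "prod_cat C D =
     \<lparr>Obj = Obj C \<times> Obj D,
      Arr = Arr C \<times> Arr D,
      Dom = (\<lambda>(f, g). (Dom C f, Dom D g)),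
      Cod = (\<lambda>(f, g). (Cod C f, Cod D g)),
      Ide = (\<lambda>(A, B). (Ide C A, Ide D B)),
      Comp = (\<lambda>(f', g') (f, g). (f' \<cdot>\<^bsub>C\<^esub> f, g' \<cdot>\<^bsub>D\<^esub> g))\<rparr>"

definition natural_transformation ::
  "('o, 'm, 'y) category_scheme \<Rightarrow> ('p, 'n, 'z) category_scheme \<Rightarrow>
   ('o, 'm, 'p, 'n) ftor \<Rightarrow> ('o, 'm, 'p, 'n) ftor \<Rightarrow> ('o \<Rightarrow> 'n) \<Rightarrow> bool"
where
  "natural_transformation C D F G \<alpha> \<longleftrightarrow>
     is_functor C D F \<and> is_functor C D G \<and>
     \<alpha> \<in> extensional (Obj C) \<and>
     (\<forall>A \<in> Obj C. \<alpha> A \<in> hom D (fobj F A) (fobj G A)) \<and>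
     (\<forall>A B f. f \<in> hom C A B \<longrightarrow> farr G f \<cdot>\<^bsub>D\<^esub> \<alpha> A = \<alpha> B \<cdot>\<^bsub>D\<^esub> farr F f)"

text \<open>An arrow of the functor category carries its source and target functors.\<close>

type_synonym ('o, 'm, 'p, 'n) transf =
  "('o, 'm, 'p, 'n) ftor \<times> ('o, 'm, 'p, 'n) ftor \<times> ('o \<Rightarrow> 'n)"

definition fun_cat ::
  "('o, 'm, 'y) category_scheme \<Rightarrow> ('p, 'n, 'z) category_scheme \<Rightarrow>
   (('o, 'm, 'p, 'n) ftor, ('o, 'm, 'p, 'n) transf) category"
where
  "fun_cat C D =
     \<lparr>Obj = {F. is_functor C D F},
      Arr = {(F, G, \<alpha>). natural_transformation C D F G \<alpha>},
      Dom = (\<lambda>(F, G, \<alpha>). F),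
      Cod = (\<lambda>(F, G, \<alpha>). G),
      Ide = (\<lambda>F. (F, F, \<lambda>A \<in> Obj C. Ide D (fobj F A))),
      Comp = (\<lambda>(G, H, \<beta>) (F, G', \<alpha>). (F, H, \<lambda>A \<in> Obj C. \<beta> A \<cdot>\<^bsub>D\<^esub> \<alpha> A))\<rparr>"


section \<open>Strict monoidal categories and bimodules\<close>

record ('o, 'm) monoidal_cat = "('o, 'm) category" +
  Tensor :: "('o \<times> 'o, 'm \<times> 'm, 'o, 'm) ftor"
  Unit :: "'o"

abbreviation tensor_obj ::
  "('o, 'm, 'z) monoidal_cat_scheme \<Rightarrow> 'o \<Rightarrow> 'o \<Rightarrow> 'o"  (infixr "\<otimes>\<^sub>o\<index>" 75) where
  "tensor_obj V A B \<equiv> fobj (Tensor V) (A, B)"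

abbreviation tensor_arr ::
  "('o, 'm, 'z) monoidal_cat_scheme \<Rightarrow> 'm \<Rightarrow> 'm \<Rightarrow> 'm"  (infixr "\<otimes>\<^sub>a\<index>" 75) where
  "tensor_arr V f g \<equiv> farr (Tensor V) (f, g)"

definition strict_monoidal :: "('o, 'm, 'z) monoidal_cat_scheme \<Rightarrow> bool" where
  "strict_monoidal V \<longleftrightarrow>
     is_functor (prod_cat V V) V (Tensor V) \<and>
     Unit V \<in> Obj V \<and>
     (\<forall>A \<in> Obj V. Unit V \<otimes>\<^sub>o\<^bsub>V\<^esub> A = A \<and> A \<otimes>\<^sub>o\<^bsub>V\<^esub> Unit V = A) \<and>
     (\<forall>f \<in> Arr V. Ide V (Unit V) \<otimes>\<^sub>a\<^bsub>V\<^esub> f = f \<and> f \<otimes>\<^sub>a\<^bsub>V\<^esub> Ide V (Unit V) = f) \<and>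
     (\<forall>A \<in> Obj V. \<forall>B \<in> Obj V. \<forall>C \<in> Obj V.
        (A \<otimes>\<^sub>o\<^bsub>V\<^esub> B) \<otimes>\<^sub>o\<^bsub>V\<^esub> C = A \<otimes>\<^sub>o\<^bsub>V\<^esub> (B \<otimes>\<^sub>o\<^bsub>V\<^esub> C)) \<and>
     (\<forall>f \<in> Arr V. \<forall>g \<in> Arr V. \<forall>h \<in> Arr V.
        (f \<otimes>\<^sub>a\<^bsub>V\<^esub> g) \<otimes>\<^sub>a\<^bsub>V\<^esub> h = f \<otimes>\<^sub>a\<^bsub>V\<^esub> (g \<otimes>\<^sub>a\<^bsub>V\<^esub> h))"

definition op_monoidal :: "('o, 'm, 'z) monoidal_cat_scheme \<Rightarrow> ('o, 'm) monoidal_cat" where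
  "op_monoidal V =
     \<lparr>Obj = Obj V, Arr = Arr V, Dom = Cod V, Cod = Dom V, Ide = Ide V,
      Comp = (\<lambda>g f. f \<cdot>\<^bsub>V\<^esub> g), Tensor = Tensor V, Unit = Unit V\<rparr>"

text \<open>A category with strict left and right actions of a monoidal category and a
  compatibility \<open>Chi A M B : A \<rhd> (M \<lhd> B) \<rightarrow> (A \<rhd> M) \<lhd> B\<close>, not required to be invertible.\<close>

record ('a, 'f, 'o, 'm) bimodule =
  Under :: "('o, 'm) category"
  LAct :: "('a \<times> 'o, 'f \<times> 'm, 'o, 'm) ftor"
  RAct :: "('o \<times> 'a, 'm \<times> 'f, 'o, 'm) ftor"
  Chi :: "'a \<Rightarrow> 'o \<Rightarrow> 'a \<Rightarrow> 'm"

abbreviation lact_obj ::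
  "('a, 'f, 'o, 'm, 'z) bimodule_scheme \<Rightarrow> 'a \<Rightarrow> 'o \<Rightarrow> 'o"  (infixr "\<rhd>\<^sub>o\<index>" 73) where
  "lact_obj M A X \<equiv> fobj (LAct M) (A, X)"

abbreviation lact_arr ::
  "('a, 'f, 'o, 'm, 'z) bimodule_scheme \<Rightarrow> 'f \<Rightarrow> 'm \<Rightarrow> 'm"  (infixr "\<rhd>\<^sub>a\<index>" 73) where
  "lact_arr M f x \<equiv> farr (LAct M) (f, x)"

abbreviation ract_obj ::
  "('a, 'f, 'o, 'm, 'z) bimodule_scheme \<Rightarrow> 'o \<Rightarrow> 'a \<Rightarrow> 'o"  (infixl "\<lhd>\<^sub>o\<index>" 73) where
  "ract_obj M X A \<equiv> fobj (RAct M) (X, A)"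

abbreviation ract_arr ::
  "('a, 'f, 'o, 'm, 'z) bimodule_scheme \<Rightarrow> 'm \<Rightarrow> 'f \<Rightarrow> 'm"  (infixl "\<lhd>\<^sub>a\<index>" 73) where
  "ract_arr M x f \<equiv> farr (RAct M) (x, f)"

definition strict_bimodule ::
  "('a, 'f, 'y) monoidal_cat_scheme \<Rightarrow> ('a, 'f, 'o, 'm, 'z) bimodule_scheme \<Rightarrow> bool"
where
  "strict_bimodule V M \<longleftrightarrow>
     strict_monoidal V \<and>
     is_functor (prod_cat V (Under M)) (Under M) (LAct M) \<and>
     is_functor (prod_cat (Under M) V) (Under M) (RAct M) \<and>
     (\<forall>X \<in> Obj (Under M). Unit V \<rhd>\<^sub>o\<^bsub>M\<^esub> X = X \<and> X \<lhd>\<^sub>o\<^bsub>M\<^esub> Unit V = X) \<and>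
     (\<forall>x \<in> Arr (Under M). Ide V (Unit V) \<rhd>\<^sub>a\<^bsub>M\<^esub> x = x \<and> x \<lhd>\<^sub>a\<^bsub>M\<^esub> Ide V (Unit V) = x) \<and>
     (\<forall>A \<in> Obj V. \<forall>B \<in> Obj V. \<forall>X \<in> Obj (Under M).
        (A \<otimes>\<^sub>o\<^bsub>V\<^esub> B) \<rhd>\<^sub>o\<^bsub>M\<^esub> X = A \<rhd>\<^sub>o\<^bsub>M\<^esub> (B \<rhd>\<^sub>o\<^bsub>M\<^esub> X) \<and>
        X \<lhd>\<^sub>o\<^bsub>M\<^esub> (A \<otimes>\<^sub>o\<^bsub>V\<^esub> B) = (X \<lhd>\<^sub>o\<^bsub>M\<^esub> A) \<lhd>\<^sub>o\<^bsub>M\<^esub> B) \<and>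
     (\<forall>f \<in> Arr V. \<forall>g \<in> Arr V. \<forall>x \<in> Arr (Under M).
        (f \<otimes>\<^sub>a\<^bsub>V\<^esub> g) \<rhd>\<^sub>a\<^bsub>M\<^esub> x = f \<rhd>\<^sub>a\<^bsub>M\<^esub> (g \<rhd>\<^sub>a\<^bsub>M\<^esub> x) \<and>
        x \<lhd>\<^sub>a\<^bsub>M\<^esub> (f \<otimes>\<^sub>a\<^bsub>V\<^esub> g) = (x \<lhd>\<^sub>a\<^bsub>M\<^esub> f) \<lhd>\<^sub>a\<^bsub>M\<^esub> g) \<and>
     (\<forall>A \<in> Obj V. \<forall>X \<in> Obj (Under M). \<forall>B \<in> Obj V.
        Chi M A X B \<in> hom (Under M) (A \<rhd>\<^sub>o\<^bsub>M\<^esub> (X \<lhd>\<^sub>o\<^bsub>M\<^esub> B)) ((A \<rhd>\<^sub>o\<^bsub>M\<^esub> X) \<lhd>\<^sub>o\<^bsub>M\<^esub> B)) \<and>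
     (\<forall>f \<in> Arr V. \<forall>x \<in> Arr (Under M). \<forall>g \<in> Arr V.
        ((f \<rhd>\<^sub>a\<^bsub>M\<^esub> x) \<lhd>\<^sub>a\<^bsub>M\<^esub> g) \<cdot>\<^bsub>Under M\<^esub> Chi M (Dom V f) (Dom (Under M) x) (Dom V g) =
        Chi M (Cod V f) (Cod (Under M) x) (Cod V g) \<cdot>\<^bsub>Under M\<^esub> (f \<rhd>\<^sub>a\<^bsub>M\<^esub> (x \<lhd>\<^sub>a\<^bsub>M\<^esub> g))) \<and>
     (\<forall>A \<in> Obj V. \<forall>X \<in> Obj (Under M).
        Chi M (Unit V) X A = Ide (Under M) (X \<lhd>\<^sub>o\<^bsub>M\<^esub> A) \<and>
        Chi M A X (Unit V) = Ide (Under M) (A \<rhd>\<^sub>o\<^bsub>M\<^esub> X)) \<and>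
     (\<forall>A \<in> Obj V. \<forall>A' \<in> Obj V. \<forall>X \<in> Obj (Under M). \<forall>B \<in> Obj V.
        Chi M (A \<otimes>\<^sub>o\<^bsub>V\<^esub> A') X B =
          Chi M A (A' \<rhd>\<^sub>o\<^bsub>M\<^esub> X) B \<cdot>\<^bsub>Under M\<^esub> (Ide V A \<rhd>\<^sub>a\<^bsub>M\<^esub> Chi M A' X B)) \<and>
     (\<forall>A \<in> Obj V. \<forall>X \<in> Obj (Under M). \<forall>B \<in> Obj V. \<forall>B' \<in> Obj V.
        Chi M A X (B \<otimes>\<^sub>o\<^bsub>V\<^esub> B') =
          (Chi M A X B \<lhd>\<^sub>a\<^bsub>M\<^esub> Ide V B') \<cdot>\<^bsub>Under M\<^esub> Chi M A (X \<lhd>\<^sub>o\<^bsub>M\<^esub> B) B')"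


section \<open>The category \<open>H\<^sup>0\<close>\<close>

definition H0_obj ::
  "('a, 'f, 'y) monoidal_cat_scheme \<Rightarrow> ('a, 'f, 'o, 'm, 'z) bimodule_scheme \<Rightarrow> 'o \<Rightarrow> ('a \<Rightarrow> 'm) \<Rightarrow> bool"
where
  "H0_obj V M X \<rho> \<longleftrightarrow>
     X \<in> Obj (Under M) \<and>
     \<rho> \<in> extensional (Obj V) \<and>
     (\<forall>A \<in> Obj V. \<rho> A \<in> hom (Under M) (A \<rhd>\<^sub>o\<^bsub>M\<^esub> X) (X \<lhd>\<^sub>o\<^bsub>M\<^esub> A)) \<and>
     (\<forall>A B f. f \<in> hom V A B \<longrightarrow>
        (Ide (Under M) X \<lhd>\<^sub>a\<^bsub>M\<^esub> f) \<cdot>\<^bsub>Under M\<^esub> \<rho> A =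
        \<rho> B \<cdot>\<^bsub>Under M\<^esub> (f \<rhd>\<^sub>a\<^bsub>M\<^esub> Ide (Under M) X)) \<and>
     \<rho> (Unit V) = Ide (Under M) X \<and>
     (\<forall>A \<in> Obj V. \<forall>B \<in> Obj V.
        \<rho> (A \<otimes>\<^sub>o\<^bsub>V\<^esub> B) =
          (\<rho> A \<lhd>\<^sub>a\<^bsub>M\<^esub> Ide V B) \<cdot>\<^bsub>Under M\<^esub> Chi M A X B \<cdot>\<^bsub>Under M\<^esub> (Ide V A \<rhd>\<^sub>a\<^bsub>M\<^esub> \<rho> B))"

definition H0 ::
  "('a, 'f, 'y) monoidal_cat_scheme \<Rightarrow> ('a, 'f, 'o, 'm, 'z) bimodule_scheme \<Rightarrow>
   ('o \<times> ('a \<Rightarrow> 'm), ('o \<times> ('a \<Rightarrow> 'm)) \<times> ('o \<times> ('a \<Rightarrow> 'm)) \<times> 'm) category"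
where
  "H0 V M =
     \<lparr>Obj = {(X, \<rho>). H0_obj V M X \<rho>},
      Arr = {((X, \<rho>), (X', \<rho>'), f). H0_obj V M X \<rho> \<and> H0_obj V M X' \<rho>' \<and>
               f \<in> hom (Under M) X X' \<and>
               (\<forall>A \<in> Obj V. (f \<lhd>\<^sub>a\<^bsub>M\<^esub> Ide V A) \<cdot>\<^bsub>Under M\<^esub> \<rho> A =
                             \<rho>' A \<cdot>\<^bsub>Under M\<^esub> (Ide V A \<rhd>\<^sub>a\<^bsub>M\<^esub> f))},
      Dom = (\<lambda>(P, Q, f). P),
      Cod = (\<lambda>(P, Q, f). Q),
      Ide = (\<lambda>P. (P, P, Ide (Under M) (fst P))),
      Comp = (\<lambda>(Q, R, g) (P, Q', f). (P, R, g \<cdot>\<^bsub>Under M\<^esub> f))\<rparr>"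


section \<open>The augmented simplicial category\<close>

text \<open>The natural number \<open>k\<close> stands for the \<open>k\<close>-element ordinal \<open>{0..<k}\<close>, usually written
  \<open>\<^bold>n\<close> with \<open>n = k - 1 \<ge> -1\<close>. With this shift the ordinal sum is addition and the
  monoidal unit, the empty ordinal, is \<open>0\<close>. An arrow is a triple of source, target and function.\<close>

type_synonym ordmap = "nat \<times> nat \<times> (nat \<Rightarrow> nat)"

definition ordmaps :: "ordmap set" where
  "ordmaps = {(m, n, f). f \<in> {..<m} \<rightarrow>\<^sub>E {..<n} \<and> mono_on {..<m} f}"

definition ord_sum :: "ordmap \<Rightarrow> ordmap \<Rightarrow> ordmap" where
  "ord_sum = (\<lambda>(m, n, f) (m', n', g).
     (m + m', n + n', \<lambda>i \<in> {..<m + m'}. if i < m then f i else n + g (i - m)))"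

definition Delta_plus :: "(nat, ordmap) monoidal_cat" where
  "Delta_plus =
     \<lparr>Obj = UNIV,
      Arr = ordmaps,
      Dom = (\<lambda>(m, n, f). m),
      Cod = (\<lambda>(m, n, f). n),
      Ide = (\<lambda>m. (m, m, \<lambda>i \<in> {..<m}. i)),
      Comp = (\<lambda>(n, p, g) (m, n', f). (m, p, compose {..<m} g f)),
      Tensor = \<lparr>fobj = (\<lambda>(m, n). m + n), farr = (\<lambda>(f, g) \<in> ordmaps \<times> ordmaps. ord_sum f g)\<rparr>,
      Unit = 0\<rparr>"

abbreviation Delta_plus_op :: "(nat, ordmap) monoidal_cat" where
  "Delta_plus_op \<equiv> op_monoidal Delta_plus"


section \<open>The bimodule structure on \<open>[V, Y]\<close>\<close>

text \<open>For a strict monoidal category \<open>V\<close>, the functor category \<open>[V, Y]\<close> has the actions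
  \<open>(A \<rhd> X)(B) = X(B \<otimes> A)\<close> and \<open>(X \<lhd> A)(B) = X(A \<otimes> B)\<close>.\<close>

definition lshift ::
  "('a, 'f, 'y) monoidal_cat_scheme \<Rightarrow> 'a \<Rightarrow> ('a, 'f, 'o, 'm) ftor \<Rightarrow> ('a, 'f, 'o, 'm) ftor"
where
  "lshift V A X =
     \<lparr>fobj = (\<lambda>B \<in> Obj V. fobj X (B \<otimes>\<^sub>o\<^bsub>V\<^esub> A)),
      farr = (\<lambda>g \<in> Arr V. farr X (g \<otimes>\<^sub>a\<^bsub>V\<^esub> Ide V A))\<rparr>"

definition rshift ::
  "('a, 'f, 'y) monoidal_cat_scheme \<Rightarrow> ('a, 'f, 'o, 'm) ftor \<Rightarrow> 'a \<Rightarrow> ('a, 'f, 'o, 'm) ftor"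
where
  "rshift V X A =
     \<lparr>fobj = (\<lambda>B \<in> Obj V. fobj X (A \<otimes>\<^sub>o\<^bsub>V\<^esub> B)),
      farr = (\<lambda>g \<in> Arr V. farr X (Ide V A \<otimes>\<^sub>a\<^bsub>V\<^esub> g))\<rparr>"

definition lshift_transf ::
  "('a, 'f, 'y) monoidal_cat_scheme \<Rightarrow> ('o, 'm, 'z) category_scheme \<Rightarrow>
   'f \<Rightarrow> ('a, 'f, 'o, 'm) transf \<Rightarrow> ('a, 'f, 'o, 'm) transf"
where
  "lshift_transf V Y f = (\<lambda>(X, X', \<alpha>).
     (lshift V (Dom V f) X, lshift V (Cod V f) X',
      \<lambda>B \<in> Obj V. \<alpha> (B \<otimes>\<^sub>o\<^bsub>V\<^esub> Cod V f) \<cdot>\<^bsub>Y\<^esub> farr X (Ide V B \<otimes>\<^sub>a\<^bsub>V\<^esub> f)))"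

definition rshift_transf ::
  "('a, 'f, 'y) monoidal_cat_scheme \<Rightarrow> ('o, 'm, 'z) category_scheme \<Rightarrow>
   ('a, 'f, 'o, 'm) transf \<Rightarrow> 'f \<Rightarrow> ('a, 'f, 'o, 'm) transf"
where
  "rshift_transf V Y = (\<lambda>(X, X', \<alpha>) f.
     (rshift V X (Dom V f), rshift V X' (Cod V f),
      \<lambda>B \<in> Obj V. \<alpha> (Cod V f \<otimes>\<^sub>o\<^bsub>V\<^esub> B) \<cdot>\<^bsub>Y\<^esub> farr X (f \<otimes>\<^sub>a\<^bsub>V\<^esub> Ide V B)))"

definition shift_bimodule ::
  "('a, 'f, 'y) monoidal_cat_scheme \<Rightarrow> ('o, 'm, 'z) category_scheme \<Rightarrow>
   ('a, 'f, ('a, 'f, 'o, 'm) ftor, ('a, 'f, 'o, 'm) transf) bimodule"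
where
  "shift_bimodule V Y =
     \<lparr>Under = fun_cat V Y,
      LAct = \<lparr>fobj = (\<lambda>(A, X) \<in> Obj V \<times> Obj (fun_cat V Y). lshift V A X),
              farr = (\<lambda>(f, \<alpha>) \<in> Arr V \<times> Arr (fun_cat V Y). lshift_transf V Y f \<alpha>)\<rparr>,
      RAct = \<lparr>fobj = (\<lambda>(X, A) \<in> Obj (fun_cat V Y) \<times> Obj V. rshift V X A),
              farr = (\<lambda>(\<alpha>, f) \<in> Arr (fun_cat V Y) \<times> Arr V. rshift_transf V Y \<alpha> f)\<rparr>,
      Chi = (\<lambda>A X B. Ide (fun_cat V Y) (lshift V A (rshift V X B)))\<rparr>"


section \<open>Augmented duplicial objects\<close>

text \<open>Augmented simplicial objects are functors on \<open>Delta_plus_op\<close>. In what follows \<open>n\<close> is the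
  simplicial degree: \<open>X\<^sub>n = fobj X (n + 1)\<close>, and \<open>face X n i : X\<^sub>n \<rightarrow> X\<^sub>n\<^sub>-\<^sub>1\<close>,
  \<open>degen X n i : X\<^sub>n \<rightarrow> X\<^sub>n\<^sub>+\<^sub>1\<close> for \<open>0 \<le> i \<le> n\<close>; likewise \<open>t n : X\<^sub>n \<rightarrow> X\<^sub>n\<close>. There is no \<open>t\<close> on \<open>X\<^sub>-\<^sub>1\<close>.\<close>

definition coface :: "nat \<Rightarrow> nat \<Rightarrow> ordmap" where
  "coface n i = (n, n + 1, \<lambda>j \<in> {..<n}. if j < i then j else j + 1)"

definition codegen :: "nat \<Rightarrow> nat \<Rightarrow> ordmap" where
  "codegen n i = (n + 2, n + 1, \<lambda>j \<in> {..<n + 2}. if j \<le> i then j else j - 1)"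

definition face :: "(nat, ordmap, 'o, 'm) ftor \<Rightarrow> nat \<Rightarrow> nat \<Rightarrow> 'm" where
  "face X n i = farr X (coface n i)"

definition degen :: "(nat, ordmap, 'o, 'm) ftor \<Rightarrow> nat \<Rightarrow> nat \<Rightarrow> 'm" where
  "degen X n i = farr X (codegen n i)"

definition duplicial_obj ::
  "('o, 'm, 'z) category_scheme \<Rightarrow> (nat, ordmap, 'o, 'm) ftor \<Rightarrow> (nat \<Rightarrow> 'm) \<Rightarrow> bool"
where
  "duplicial_obj Y X t \<longleftrightarrow>
     X \<in> Obj (fun_cat Delta_plus_op Y) \<and>
     (\<forall>n. t n \<in> hom Y (fobj X (n + 1)) (fobj X (n + 1))) \<and>
     (\<forall>n i. 1 \<le> i \<and> i \<le> n \<longrightarrow> face X n i \<cdot>\<^bsub>Y\<^esub> t n = t (n - 1) \<cdot>\<^bsub>Y\<^esub> face X n (i - 1)) \<and>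
     (\<forall>n. face X n 0 \<cdot>\<^bsub>Y\<^esub> t n = face X n n) \<and>
     (\<forall>n j. 1 \<le> j \<and> j \<le> n \<longrightarrow> degen X n j \<cdot>\<^bsub>Y\<^esub> t n = t (n + 1) \<cdot>\<^bsub>Y\<^esub> degen X n (j - 1)) \<and>
     (\<forall>n. degen X n 0 \<cdot>\<^bsub>Y\<^esub> t n = t (n + 1) \<cdot>\<^bsub>Y\<^esub> t (n + 1) \<cdot>\<^bsub>Y\<^esub> degen X n n)"

definition duplicial_cat ::
  "('o, 'm, 'z) category_scheme \<Rightarrow>
   ((nat, ordmap, 'o, 'm) ftor \<times> (nat \<Rightarrow> 'm),
    ((nat, ordmap, 'o, 'm) ftor \<times> (nat \<Rightarrow> 'm)) \<times> ((nat, ordmap, 'o, 'm) ftor \<times> (nat \<Rightarrow> 'm)) \<times>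
      (nat, ordmap, 'o, 'm) transf) category"
where
  "duplicial_cat Y =
     \<lparr>Obj = {(X, t). duplicial_obj Y X t},
      Arr = {((X, t), (X', t'), f). duplicial_obj Y X t \<and> duplicial_obj Y X' t' \<and>
               f \<in> hom (fun_cat Delta_plus_op Y) X X' \<and>
               (\<forall>n. snd (snd f) (n + 1) \<cdot>\<^bsub>Y\<^esub> t n = t' n \<cdot>\<^bsub>Y\<^esub> snd (snd f) (n + 1))},
      Dom = (\<lambda>(P, Q, f). P),
      Cod = (\<lambda>(P, Q, f). Q),
      Ide = (\<lambda>P. (P, P, Ide (fun_cat Delta_plus_op Y) (fst P))),
      Comp = (\<lambda>(Q, R, g) (P, Q', f). (P, R, g \<cdot>\<^bsub>fun_cat Delta_plus_op Y\<^esub> f))\<rparr>"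


section \<open>Well-definedness\<close>

lemma homI: "\<lbrakk>f \<in> Arr C; Dom C f = A; Cod C f = B\<rbrakk> \<Longrightarrow> f \<in> hom C A B"
  by (simp add: hom_def)

lemma homD: "f \<in> hom C A B \<Longrightarrow> f \<in> Arr C \<and> Dom C f = A \<and> Cod C f = B"
  by (simp add: hom_def)

lemma prod_cat_simps:
  "Obj (prod_cat C D) = Obj C \<times> Obj D"
  "Arr (prod_cat C D) = Arr C \<times> Arr D"
  "Dom (prod_cat C D) (f, g) = (Dom C f, Dom D g)"
  "Cod (prod_cat C D) (f, g) = (Cod C f, Cod D g)"
  "Ide (prod_cat C D) (A, B) = (Ide C A, Ide D B)"
  "(f', g') \<cdot>\<^bsub>prod_cat C D\<^esub> (f, g) = (f' \<cdot>\<^bsub>C\<^esub> f, g' \<cdot>\<^bsub>D\<^esub> g)"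
  by (simp_all add: prod_cat_def)

lemma hom_prod_cat:
  "(f, g) \<in> hom (prod_cat C D) (A, B) (A', B') \<longleftrightarrow> f \<in> hom C A A' \<and> g \<in> hom D B B'"
  by (auto simp: prod_cat_def hom_def)

lemma category_prod_cat:
  assumes "category C" and "category D"
  shows "category (prod_cat C D)"
proof -
  interpret C: category C by fact
  interpret D: category D by fact
  show ?thesis
    by unfold_locales
      (auto simp: hom_prod_cat prod_cat_simps C.Ide_in D.Ide_in C.Dom_in D.Dom_in C.Cod_in D.Cod_in
        intro: C.Comp_in D.Comp_in C.Comp_Ide D.Comp_Ide C.Ide_Comp D.Ide_Comp
          C.Comp_assoc D.Comp_assoc)
qed

lemma hom_op_monoidal [simp]: "hom (op_monoidal V) A B = hom V B A"
  by (auto simp: op_monoidal_def hom_def)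

lemma category_op_monoidal:
  assumes "category V"
  shows "category (op_monoidal V)"
proof -
  interpret category V by fact
  show ?thesis
    by unfold_locales
      (auto simp: op_monoidal_def[of V] hom_op_monoidal[unfolded op_monoidal_def] Dom_in Cod_in Ide_in
        intro: Comp_in Comp_Ide Ide_Comp Comp_assoc[symmetric])
qed

lemma strict_monoidal_op_monoidal:
  assumes "strict_monoidal V"
  shows "strict_monoidal (op_monoidal V)"
proof -
  have F: "is_functor (prod_cat V V) V (Tensor V)" using assms by (simp add: strict_monoidal_def)
  have V: "category V" using F by (simp add: is_functor_def)
  have h: "p \<in> hom (prod_cat (op_monoidal V) (op_monoidal V)) A B \<longleftrightarrow> p \<in> hom (prod_cat V V) B A"
    for p A B
    by (auto simp: prod_cat_def op_monoidal_def hom_def split: prod.splits)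
  have c: "p \<cdot>\<^bsub>prod_cat (op_monoidal V) (op_monoidal V)\<^esub> q = q \<cdot>\<^bsub>prod_cat V V\<^esub> p" for p q
    by (auto simp: prod_cat_def op_monoidal_def split: prod.splits)
  have "is_functor (prod_cat (op_monoidal V) (op_monoidal V)) (op_monoidal V) (Tensor V)"
    unfolding is_functor_def h c
    using F category_prod_cat category_op_monoidal[OF V]
    by (auto simp: is_functor_def) (auto simp: op_monoidal_def prod_cat_def)
  with assms show ?thesis
    by (simp add: strict_monoidal_def) (simp add: op_monoidal_def)
qed

lemma fun_cat_simps:
  "Obj (fun_cat C D) = {F. is_functor C D F}"
  "Dom (fun_cat C D) (F, G, \<alpha>) = F"
  "Cod (fun_cat C D) (F, G, \<alpha>) = G"
  "Ide (fun_cat C D) F = (F, F, \<lambda>A \<in> Obj C. Ide D (fobj F A))"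
  "(G, H, \<beta>) \<cdot>\<^bsub>fun_cat C D\<^esub> (F, G', \<alpha>) = (F, H, \<lambda>A \<in> Obj C. \<beta> A \<cdot>\<^bsub>D\<^esub> \<alpha> A)"
  by (simp_all add: fun_cat_def)

lemma hom_fun_cat:
  "p \<in> hom (fun_cat C D) F G \<longleftrightarrow> (\<exists>\<alpha>. p = (F, G, \<alpha>) \<and> natural_transformation C D F G \<alpha>)"
  by (auto simp: hom_def fun_cat_def)

lemma Arr_fun_cat:
  "p \<in> Arr (fun_cat C D) \<longleftrightarrow> (\<exists>F G \<alpha>. p = (F, G, \<alpha>) \<and> natural_transformation C D F G \<alpha>)"
  by (auto simp: fun_cat_def)

lemma functor_in:
  assumes "is_functor C D F"
  shows "category C" "category D" "A \<in> Obj C \<Longrightarrow> fobj F A \<in> Obj D"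
    "f \<in> hom C A B \<Longrightarrow> farr F f \<in> hom D (fobj F A) (fobj F B)"
    "A \<in> Obj C \<Longrightarrow> farr F (Ide C A) = Ide D (fobj F A)"
    "\<lbrakk>f \<in> hom C A B; g \<in> hom C B E\<rbrakk> \<Longrightarrow> farr F (g \<cdot>\<^bsub>C\<^esub> f) = farr F g \<cdot>\<^bsub>D\<^esub> farr F f"
  using assms by (auto simp: is_functor_def)

lemma (in category) hom_Obj: "f \<in> hom C A B \<Longrightarrow> A \<in> Obj C \<and> B \<in> Obj C"
  using Dom_in Cod_in by (auto simp: hom_def)

lemma natural_transformation_Ide:
  assumes F: "is_functor C D F"
  shows "natural_transformation C D F F (\<lambda>A \<in> Obj C. Ide D (fobj F A))"
proof -
  interpret C: category C using F by (rule functor_in)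
  interpret D: category D using F by (rule functor_in)
  show ?thesis
    unfolding natural_transformation_def
    using F by (auto simp: functor_in[OF F] D.Ide_in C.hom_Obj
      D.Comp_Ide[OF functor_in(4)[OF F]] D.Ide_Comp[OF functor_in(4)[OF F]])
qed

lemma natural_transformation_Comp:
  assumes a: "natural_transformation C D F G \<alpha>" and b: "natural_transformation C D G H \<beta>"
  shows "natural_transformation C D F H (\<lambda>A \<in> Obj C. \<beta> A \<cdot>\<^bsub>D\<^esub> \<alpha> A)"
proof -
  have F: "is_functor C D F" and G: "is_functor C D G" and H: "is_functor C D H"
    using a b by (auto simp: natural_transformation_def)
  interpret C: category C using F by (rule functor_in)
  interpret D: category D using F by (rule functor_in)
  have a1: "A \<in> Obj C \<Longrightarrow> \<alpha> A \<in> hom D (fobj F A) (fobj G A)"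
    and b1: "A \<in> Obj C \<Longrightarrow> \<beta> A \<in> hom D (fobj G A) (fobj H A)" for A
    using a b by (auto simp: natural_transformation_def)
  have a2: "f \<in> hom C A B \<Longrightarrow> farr G f \<cdot>\<^bsub>D\<^esub> \<alpha> A = \<alpha> B \<cdot>\<^bsub>D\<^esub> farr F f"
    and b2: "f \<in> hom C A B \<Longrightarrow> farr H f \<cdot>\<^bsub>D\<^esub> \<beta> A = \<beta> B \<cdot>\<^bsub>D\<^esub> farr G f" for A B f
    using a b by (auto simp: natural_transformation_def)
  have "farr H f \<cdot>\<^bsub>D\<^esub> (\<beta> A \<cdot>\<^bsub>D\<^esub> \<alpha> A) = (\<beta> B \<cdot>\<^bsub>D\<^esub> \<alpha> B) \<cdot>\<^bsub>D\<^esub> farr F f"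
    if f: "f \<in> hom C A B" for A B f
  proof -
    have A: "A \<in> Obj C" and B: "B \<in> Obj C" using C.hom_Obj[OF f] by auto
    note i = functor_in(4)[OF F f] functor_in(4)[OF G f] functor_in(4)[OF H f]
      a1[OF A] a1[OF B] b1[OF A] b1[OF B]
    have "farr H f \<cdot>\<^bsub>D\<^esub> (\<beta> A \<cdot>\<^bsub>D\<^esub> \<alpha> A) = (farr H f \<cdot>\<^bsub>D\<^esub> \<beta> A) \<cdot>\<^bsub>D\<^esub> \<alpha> A"
      using D.Comp_assoc i by metis
    also have "\<dots> = (\<beta> B \<cdot>\<^bsub>D\<^esub> farr G f) \<cdot>\<^bsub>D\<^esub> \<alpha> A" by (simp add: b2[OF f])
    also have "\<dots> = \<beta> B \<cdot>\<^bsub>D\<^esub> (farr G f \<cdot>\<^bsub>D\<^esub> \<alpha> A)" using D.Comp_assoc i by metis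
    also have "\<dots> = \<beta> B \<cdot>\<^bsub>D\<^esub> (\<alpha> B \<cdot>\<^bsub>D\<^esub> farr F f)" by (simp add: a2[OF f])
    also have "\<dots> = (\<beta> B \<cdot>\<^bsub>D\<^esub> \<alpha> B) \<cdot>\<^bsub>D\<^esub> farr F f" using D.Comp_assoc i by metis
    finally show ?thesis .
  qed
  then show ?thesis
    unfolding natural_transformation_def
    using F H C.hom_Obj by (auto intro: D.Comp_in[OF a1 b1])
qed

lemma category_fun_cat:
  assumes C: "category C" and D: "category D"
  shows "category (fun_cat C D)"
proof -
  interpret C: category C by fact
  interpret D: category D by fact
  have nt: "natural_transformation C D F G \<alpha> \<Longrightarrow> A \<in> Obj C \<Longrightarrow> \<alpha> A \<in> hom D (fobj F A) (fobj G A)"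
    "natural_transformation C D F G \<alpha> \<Longrightarrow> \<alpha> \<in> extensional (Obj C)" for F G \<alpha> A
    by (auto simp: natural_transformation_def)
  show ?thesis
  proof
    fix f assume "f \<in> Arr (fun_cat C D)"
    then show "Dom (fun_cat C D) f \<in> Obj (fun_cat C D)" "Cod (fun_cat C D) f \<in> Obj (fun_cat C D)"
      by (auto simp: Arr_fun_cat fun_cat_simps natural_transformation_def)
  next
    fix A assume "A \<in> Obj (fun_cat C D)"
    then show "Ide (fun_cat C D) A \<in> hom (fun_cat C D) A A"
      by (auto simp: hom_fun_cat fun_cat_simps natural_transformation_Ide)
  next
    fix f g A B E
    assume "f \<in> hom (fun_cat C D) A B" "g \<in> hom (fun_cat C D) B E"
    then show "g \<cdot>\<^bsub>fun_cat C D\<^esub> f \<in> hom (fun_cat C D) A E"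
      by (auto simp: hom_fun_cat fun_cat_simps natural_transformation_Comp)
  next
    fix f A B assume f: "f \<in> hom (fun_cat C D) A B"
    then obtain \<alpha> where a: "f = (A, B, \<alpha>)" "natural_transformation C D A B \<alpha>"
      by (auto simp: hom_fun_cat)
    show "f \<cdot>\<^bsub>fun_cat C D\<^esub> Ide (fun_cat C D) A = f"
      unfolding a(1) fun_cat_simps
      using D.Comp_Ide[OF nt(1)[OF a(2)]] nt(2)[OF a(2)]
      by (auto simp: fun_eq_iff extensional_def)
    show "Ide (fun_cat C D) B \<cdot>\<^bsub>fun_cat C D\<^esub> f = f"
      unfolding a(1) fun_cat_simps
      using D.Ide_Comp[OF nt(1)[OF a(2)]] nt(2)[OF a(2)]
      by (auto simp: fun_eq_iff extensional_def)
  next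
    fix f g h A B E K
    assume "f \<in> hom (fun_cat C D) A B" "g \<in> hom (fun_cat C D) B E" "h \<in> hom (fun_cat C D) E K"
    then obtain \<alpha> \<beta> \<gamma> where e: "f = (A, B, \<alpha>)" "g = (B, E, \<beta>)" "h = (E, K, \<gamma>)"
      and n: "natural_transformation C D A B \<alpha>" "natural_transformation C D B E \<beta>"
        "natural_transformation C D E K \<gamma>"
      by (auto simp: hom_fun_cat)
    show "(h \<cdot>\<^bsub>fun_cat C D\<^esub> g) \<cdot>\<^bsub>fun_cat C D\<^esub> f = h \<cdot>\<^bsub>fun_cat C D\<^esub> (g \<cdot>\<^bsub>fun_cat C D\<^esub> f)"
      unfolding e fun_cat_simps
      using D.Comp_assoc[OF n(1)[THEN nt(1)] n(2)[THEN nt(1)] n(3)[THEN nt(1)]]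
      by (auto simp: fun_eq_iff)
  qed
qed

lemma is_functor_prod_catI:
  assumes C: "category C" and D: "category D" and E: "category E"
    and obj: "fobj F \<in> Obj C \<times> Obj D \<rightarrow>\<^sub>E Obj E"
    and ext: "farr F \<in> extensional (Arr C \<times> Arr D)"
    and arr: "\<And>f g A A' B B'. \<lbrakk>f \<in> hom C A A'; g \<in> hom D B B'\<rbrakk>
      \<Longrightarrow> farr F (f, g) \<in> hom E (fobj F (A, B)) (fobj F (A', B'))"
    and ide: "\<And>A B. \<lbrakk>A \<in> Obj C; B \<in> Obj D\<rbrakk>
      \<Longrightarrow> farr F (Ide C A, Ide D B) = Ide E (fobj F (A, B))"
    and comp: "\<And>f g f' g' A A' A'' B B' B''.
      \<lbrakk>f \<in> hom C A A'; f' \<in> hom C A' A''; g \<in> hom D B B'; g' \<in> hom D B' B''\<rbrakk>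
      \<Longrightarrow> farr F (f' \<cdot>\<^bsub>C\<^esub> f, g' \<cdot>\<^bsub>D\<^esub> g) = farr F (f', g') \<cdot>\<^bsub>E\<^esub> farr F (f, g)"
  shows "is_functor (prod_cat C D) E F"
  unfolding is_functor_def
proof (intro conjI allI impI ballI, goal_cases)
  case 1 show ?case using C D by (rule category_prod_cat)
next
  case 2 show ?case by (rule E)
next
  case 3 show ?case using obj by (simp add: prod_cat_simps)
next
  case 4 show ?case using ext by (simp add: prod_cat_simps)
next
  case (5 A B f)
  then show ?case using arr by (cases A; cases B; cases f) (simp add: hom_prod_cat)
next
  case (6 A)
  then show ?case using ide by (cases A) (simp add: prod_cat_simps)
next
  case (7 A B A' f g)
  then show ?case
    by (cases A; cases B; cases A'; cases f; cases g)
      (auto simp: hom_prod_cat prod_cat_simps intro: comp)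
qed

lemma hom_Delta_plus:
  "p \<in> hom Delta_plus m n \<longleftrightarrow>
    (\<exists>f. p = (m, n, f) \<and> f \<in> extensional {..<m} \<and> (\<forall>i<m. f i < n) \<and> (\<forall>i j. i \<le> j \<and> j < m \<longrightarrow> f i \<le> f j))"
  by (fastforce simp: hom_def Delta_plus_def ordmaps_def PiE_iff mono_on_def)

lemma ordmaps_iff:
  "(m, n, f) \<in> ordmaps \<longleftrightarrow>
    f \<in> extensional {..<m} \<and> (\<forall>i<m. f i < n) \<and> (\<forall>i j. i \<le> j \<and> j < m \<longrightarrow> f i \<le> f j)"
  by (fastforce simp: ordmaps_def PiE_iff mono_on_def)

lemma category_Delta_plus: "category Delta_plus"
proof
  fix f g h :: ordmap and A B E K
  show "Dom Delta_plus f \<in> Obj Delta_plus" "Cod Delta_plus f \<in> Obj Delta_plus"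
    by (simp_all add: Delta_plus_def)
  show "Ide Delta_plus A \<in> hom Delta_plus A A"
    by (simp add: hom_Delta_plus) (simp add: Delta_plus_def)
  show "f \<in> hom Delta_plus A B \<Longrightarrow> f \<cdot>\<^bsub>Delta_plus\<^esub> Ide Delta_plus A = f"
    "f \<in> hom Delta_plus A B \<Longrightarrow> Ide Delta_plus B \<cdot>\<^bsub>Delta_plus\<^esub> f = f"
    by (auto simp: hom_Delta_plus) (auto simp: Delta_plus_def compose_def fun_eq_iff extensional_def)
  assume f: "f \<in> hom Delta_plus A B" and g: "g \<in> hom Delta_plus B E"
  then show "g \<cdot>\<^bsub>Delta_plus\<^esub> f \<in> hom Delta_plus A E"
    by (auto simp: hom_Delta_plus) (auto simp: Delta_plus_def compose_def)
  assume h: "h \<in> hom Delta_plus E K"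
  show "(h \<cdot>\<^bsub>Delta_plus\<^esub> g) \<cdot>\<^bsub>Delta_plus\<^esub> f = h \<cdot>\<^bsub>Delta_plus\<^esub> (g \<cdot>\<^bsub>Delta_plus\<^esub> f)"
    using f g h
    by (auto simp: hom_Delta_plus) (auto simp: Delta_plus_def compose_def fun_eq_iff)
qed

lemma ord_sum_in:
  assumes "p \<in> hom Delta_plus m n" and "q \<in> hom Delta_plus m' n'"
  shows "ord_sum p q \<in> hom Delta_plus (m + m') (n + n')"
proof -
  obtain f g where e: "p = (m, n, f)" "q = (m', n', g)"
    and f: "\<And>i. i < m \<Longrightarrow> f i < n" "\<And>i j. i \<le> j \<Longrightarrow> j < m \<Longrightarrow> f i \<le> f j"
    and g: "\<And>i. i < m' \<Longrightarrow> g i < n'" "\<And>i j. i \<le> j \<Longrightarrow> j < m' \<Longrightarrow> g i \<le> g j"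
    using assms by (auto simp: hom_Delta_plus)
  let ?h = "\<lambda>i \<in> {..<m + m'}. if i < m then f i else n + g (i - m)"
  have 1: "?h i < n + n'" if "i < m + m'" for i
    using that f(1)[of i] g(1)[of "i - m"] by auto
  have 2: "?h i \<le> ?h j" if "i \<le> j" "j < m + m'" for i j
    using that f(1)[of i] f(2)[of i j] g(2)[of "i - m" "j - m"] by auto
  show ?thesis
    unfolding e hom_Delta_plus ord_sum_def prod.case using 1 2 by blast
qed

lemma Delta_plus_simps:
  "Obj Delta_plus = UNIV"
  "Arr Delta_plus = ordmaps"
  "Dom Delta_plus (m, n, f) = m"
  "Cod Delta_plus (m, n, f) = n"
  "Ide Delta_plus m = (m, m, \<lambda>i \<in> {..<m}. i)"
  "(n, p, g) \<cdot>\<^bsub>Delta_plus\<^esub> (m, n', f) = (m, p, compose {..<m} g f)"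
  "m \<otimes>\<^sub>o\<^bsub>Delta_plus\<^esub> n = m + n"
  "\<lbrakk>q \<in> ordmaps; r \<in> ordmaps\<rbrakk> \<Longrightarrow> q \<otimes>\<^sub>a\<^bsub>Delta_plus\<^esub> r = ord_sum q r"
  "Unit Delta_plus = 0"
  by (simp_all add: Delta_plus_def)

lemma hom_Delta_plus_ordmaps: "p \<in> hom Delta_plus m n \<Longrightarrow> p \<in> ordmaps"
  by (simp add: hom_def Delta_plus_simps)

lemma ordmaps_hom_Delta_plus: "p \<in> ordmaps \<Longrightarrow> p \<in> hom Delta_plus (fst p) (fst (snd p))"
  by (cases p) (simp add: hom_def Delta_plus_simps)

lemma ord_sum_Comp:
  assumes "f \<in> hom Delta_plus m n" "f' \<in> hom Delta_plus m' n'"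
    "g \<in> hom Delta_plus n p" "g' \<in> hom Delta_plus n' p'"
  shows "ord_sum (g \<cdot>\<^bsub>Delta_plus\<^esub> f) (g' \<cdot>\<^bsub>Delta_plus\<^esub> f') =
    ord_sum g g' \<cdot>\<^bsub>Delta_plus\<^esub> ord_sum f f'"
proof -
  obtain u u' v v' where e: "f = (m, n, u)" "f' = (m', n', u')" "g = (n, p, v)" "g' = (n', p', v')"
    and u: "\<And>i. i < m \<Longrightarrow> u i < n" and u': "\<And>i. i < m' \<Longrightarrow> u' i < n'"
    using assms by (auto simp: hom_Delta_plus)
  show ?thesis
    unfolding e Delta_plus_simps ord_sum_def prod.case
    using u u' by (auto simp: compose_def fun_eq_iff dest: trans_less_add1)
qed

lemma ord_sum_Ide:
  "ord_sum (Ide Delta_plus m) (Ide Delta_plus n) = Ide Delta_plus (m + n)"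
  by (auto simp: Delta_plus_simps ord_sum_def fun_eq_iff)

lemma ord_sum_Unit:
  assumes "f \<in> ordmaps"
  shows "ord_sum (Ide Delta_plus 0) f = f" "ord_sum f (Ide Delta_plus 0) = f"
  using assms
  by (cases f, auto simp: ordmaps_iff Delta_plus_simps ord_sum_def fun_eq_iff extensional_def)+

lemma ord_sum_assoc: "ord_sum (ord_sum f g) h = ord_sum f (ord_sum g h)"
proof -
  obtain m n u m' n' u' m'' n'' u''
    where e: "f = (m, n, u)" "g = (m', n', u')" "h = (m'', n'', u'')"
    by (cases f; cases g; cases h)
  show ?thesis
    unfolding e ord_sum_def prod.case
    by (auto simp: fun_eq_iff)
qed

lemma strict_monoidal_Delta_plus: "strict_monoidal Delta_plus"
proof -
  let ?V = Delta_plus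
  note hA = hom_Delta_plus_ordmaps
  interpret category ?V by (rule category_Delta_plus)
  have Ide: "Ide ?V m \<in> ordmaps" for m
    using Ide_in[of m] by (simp add: Delta_plus_simps(1) hA)
  have sum: "ord_sum f g \<in> ordmaps" if "f \<in> ordmaps" "g \<in> ordmaps" for f g
    using that by (blast intro: hA ord_sum_in ordmaps_hom_Delta_plus)
  have F: "is_functor (prod_cat ?V ?V) ?V (Tensor ?V)"
  proof (rule is_functor_prod_catI, goal_cases)
    case 4 show ?case by (simp add: Delta_plus_def)
  next
    case 5 show ?case by (auto simp: Delta_plus_def)
  next
    case 6 then show ?case by (simp add: Delta_plus_simps(7,8) hA ord_sum_in)
  next
    case 7 show ?case by (simp add: Delta_plus_simps(7,8) Ide ord_sum_Ide)
  next
    case (8 f g f' g' A A' A'' B B' B'')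
    then show ?case
      using hA[OF Comp_in[OF 8(1,2)]] hA[OF Comp_in[OF 8(3,4)]] ord_sum_Comp[OF 8(1,3,2,4)]
      by (simp add: Delta_plus_simps(8) hA)
  qed (rule category_Delta_plus)+
  show ?thesis
    unfolding strict_monoidal_def Delta_plus_simps(1,2,9)
    using F by (simp add: Delta_plus_simps(7,8) Ide sum ord_sum_Unit ord_sum_assoc)
qed

lemma strict_monoidal_facts:
  assumes "strict_monoidal V"
  shows "category V"
    "\<lbrakk>A \<in> Obj V; B \<in> Obj V\<rbrakk> \<Longrightarrow> A \<otimes>\<^sub>o\<^bsub>V\<^esub> B \<in> Obj V"
    "\<lbrakk>f \<in> hom V A A'; g \<in> hom V B B'\<rbrakk> \<Longrightarrow> f \<otimes>\<^sub>a\<^bsub>V\<^esub> g \<in> hom V (A \<otimes>\<^sub>o\<^bsub>V\<^esub> B) (A' \<otimes>\<^sub>o\<^bsub>V\<^esub> B')"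
    "\<lbrakk>A \<in> Obj V; B \<in> Obj V\<rbrakk> \<Longrightarrow> Ide V A \<otimes>\<^sub>a\<^bsub>V\<^esub> Ide V B = Ide V (A \<otimes>\<^sub>o\<^bsub>V\<^esub> B)"
    "\<lbrakk>f \<in> hom V A A'; f' \<in> hom V A' A''; g \<in> hom V B B'; g' \<in> hom V B' B''\<rbrakk>
      \<Longrightarrow> (f' \<cdot>\<^bsub>V\<^esub> f) \<otimes>\<^sub>a\<^bsub>V\<^esub> (g' \<cdot>\<^bsub>V\<^esub> g) = (f' \<otimes>\<^sub>a\<^bsub>V\<^esub> g') \<cdot>\<^bsub>V\<^esub> (f \<otimes>\<^sub>a\<^bsub>V\<^esub> g)"
    "Unit V \<in> Obj V"
    "A \<in> Obj V \<Longrightarrow> Unit V \<otimes>\<^sub>o\<^bsub>V\<^esub> A = A" "A \<in> Obj V \<Longrightarrow> A \<otimes>\<^sub>o\<^bsub>V\<^esub> Unit V = A"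
    "f \<in> hom V A A' \<Longrightarrow> Ide V (Unit V) \<otimes>\<^sub>a\<^bsub>V\<^esub> f = f" "f \<in> hom V A A' \<Longrightarrow> f \<otimes>\<^sub>a\<^bsub>V\<^esub> Ide V (Unit V) = f"
    "\<lbrakk>A \<in> Obj V; B \<in> Obj V; C \<in> Obj V\<rbrakk>
      \<Longrightarrow> (A \<otimes>\<^sub>o\<^bsub>V\<^esub> B) \<otimes>\<^sub>o\<^bsub>V\<^esub> C = A \<otimes>\<^sub>o\<^bsub>V\<^esub> (B \<otimes>\<^sub>o\<^bsub>V\<^esub> C)"
    "\<lbrakk>f \<in> hom V A A'; g \<in> hom V B B'; h \<in> hom V C C'\<rbrakk>
      \<Longrightarrow> (f \<otimes>\<^sub>a\<^bsub>V\<^esub> g) \<otimes>\<^sub>a\<^bsub>V\<^esub> h = f \<otimes>\<^sub>a\<^bsub>V\<^esub> (g \<otimes>\<^sub>a\<^bsub>V\<^esub> h)"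
proof -
  have F: "is_functor (prod_cat V V) V (Tensor V)" using assms by (simp add: strict_monoidal_def)
  note * = functor_in[OF F]
  show "category V" by (rule *)
  show "\<lbrakk>A \<in> Obj V; B \<in> Obj V\<rbrakk> \<Longrightarrow> A \<otimes>\<^sub>o\<^bsub>V\<^esub> B \<in> Obj V"
    using *(3)[of "(A, B)"] by (simp add: prod_cat_simps)
  show "\<lbrakk>f \<in> hom V A A'; g \<in> hom V B B'\<rbrakk> \<Longrightarrow> f \<otimes>\<^sub>a\<^bsub>V\<^esub> g \<in> hom V (A \<otimes>\<^sub>o\<^bsub>V\<^esub> B) (A' \<otimes>\<^sub>o\<^bsub>V\<^esub> B')"
    using *(4)[of "(f, g)" "(A, B)" "(A', B')"] by (simp add: hom_prod_cat)
  show "\<lbrakk>A \<in> Obj V; B \<in> Obj V\<rbrakk> \<Longrightarrow> Ide V A \<otimes>\<^sub>a\<^bsub>V\<^esub> Ide V B = Ide V (A \<otimes>\<^sub>o\<^bsub>V\<^esub> B)"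
    using *(5)[of "(A, B)"] by (simp add: prod_cat_simps)
  show "\<lbrakk>f \<in> hom V A A'; f' \<in> hom V A' A''; g \<in> hom V B B'; g' \<in> hom V B' B''\<rbrakk>
      \<Longrightarrow> (f' \<cdot>\<^bsub>V\<^esub> f) \<otimes>\<^sub>a\<^bsub>V\<^esub> (g' \<cdot>\<^bsub>V\<^esub> g) = (f' \<otimes>\<^sub>a\<^bsub>V\<^esub> g') \<cdot>\<^bsub>V\<^esub> (f \<otimes>\<^sub>a\<^bsub>V\<^esub> g)"
    using *(6)[of "(f, g)" "(A, B)" "(A', B')" "(f', g')" "(A'', B'')"]
    by (simp add: hom_prod_cat prod_cat_simps)
qed (use assms in \<open>auto simp: strict_monoidal_def hom_def\<close>)

lemma natural_transformation_in:
  assumes "natural_transformation C D F G \<alpha>"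
  shows "is_functor C D F" "is_functor C D G" "\<alpha> \<in> extensional (Obj C)"
    "A \<in> Obj C \<Longrightarrow> \<alpha> A \<in> hom D (fobj F A) (fobj G A)"
    "f \<in> hom C A B \<Longrightarrow> farr G f \<cdot>\<^bsub>D\<^esub> \<alpha> A = \<alpha> B \<cdot>\<^bsub>D\<^esub> farr F f"
  using assms by (auto simp: natural_transformation_def)

lemma ftor_eqI:
  fixes F G :: "('o, 'm, 'p, 'n) ftor"
  assumes "is_functor C D F" "is_functor C D G"
    "\<And>A. A \<in> Obj C \<Longrightarrow> fobj F A = fobj G A"
    "\<And>f A B. f \<in> hom C A B \<Longrightarrow> farr F f = farr G f"
  shows "F = G"
proof -
  have "fobj F = fobj G"
    using assms by (intro extensionalityI[of _ "Obj C"]) (auto simp: is_functor_def PiE_def)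
  moreover have "farr F = farr G"
    using assms by (intro extensionalityI[of _ "Arr C"]) (auto simp: is_functor_def hom_def)
  ultimately show ?thesis by (cases F; cases G) simp
qed

lemma transf_eqI:
  assumes "natural_transformation C D F G \<alpha>" "natural_transformation C D F G \<beta>"
    "\<And>A. A \<in> Obj C \<Longrightarrow> \<alpha> A = \<beta> A"
  shows "\<alpha> = \<beta>"
  using assms by (intro extensionalityI[of _ "Obj C"]) (auto simp: natural_transformation_def)

text \<open>Reversing the tensor exchanges \<open>lshift\<close> and \<open>rshift\<close>; this is only used to transfer
  facts about the left action to the right one.\<close>

definition rev_monoidal :: "('o, 'm, 'z) monoidal_cat_scheme \<Rightarrow> ('o, 'm, 'z) monoidal_cat_scheme" where
  "rev_monoidal V = V\<lparr>Tensor :=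
     \<lparr>fobj = (\<lambda>(A, B). B \<otimes>\<^sub>o\<^bsub>V\<^esub> A), farr = (\<lambda>(f, g). g \<otimes>\<^sub>a\<^bsub>V\<^esub> f)\<rparr>\<rparr>"

lemma rev_monoidal_simps [simp]:
  "Obj (rev_monoidal V) = Obj V" "Arr (rev_monoidal V) = Arr V"
  "Dom (rev_monoidal V) = Dom V" "Cod (rev_monoidal V) = Cod V"
  "Ide (rev_monoidal V) = Ide V" "Comp (rev_monoidal V) = Comp V"
  "hom (rev_monoidal V) = hom V" "Unit (rev_monoidal V) = Unit V"
  "A \<otimes>\<^sub>o\<^bsub>rev_monoidal V\<^esub> B = B \<otimes>\<^sub>o\<^bsub>V\<^esub> A" "f \<otimes>\<^sub>a\<^bsub>rev_monoidal V\<^esub> g = g \<otimes>\<^sub>a\<^bsub>V\<^esub> f"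
  by (simp_all add: rev_monoidal_def hom_def fun_eq_iff)

lemma category_rev_monoidal [simp]: "category (rev_monoidal V) = category V"
  by (simp add: category_def)

lemma is_functor_rev_monoidal [simp]: "is_functor (rev_monoidal V) Y = is_functor V Y"
  by (simp add: is_functor_def fun_eq_iff)

lemma natural_transformation_rev_monoidal [simp]:
  "natural_transformation (rev_monoidal V) Y = natural_transformation V Y"
  by (simp add: natural_transformation_def fun_eq_iff)

lemma fun_cat_rev_monoidal [simp]: "fun_cat (rev_monoidal V) Y = fun_cat V Y"
  by (simp add: fun_cat_def)

lemma strict_monoidal_rev_monoidal:
  assumes V: "strict_monoidal V"
  shows "strict_monoidal (rev_monoidal V)"
proof -
  note v = strict_monoidal_facts[OF V]
  have F: "is_functor (prod_cat V V) V (Tensor V)" using V by (simp add: strict_monoidal_def)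
  have "is_functor (prod_cat (rev_monoidal V) (rev_monoidal V)) (rev_monoidal V) (Tensor (rev_monoidal V))"
  proof (rule is_functor_prod_catI, goal_cases)
    case 4
    then show ?case using F
      by (auto simp: rev_monoidal_def is_functor_def PiE_iff extensional_def prod_cat_simps)
  next
    case 5
    then show ?case using F
      by (auto simp: rev_monoidal_def is_functor_def extensional_def prod_cat_simps)
  qed (auto simp: v intro: v)
  then show ?thesis
    using V unfolding strict_monoidal_def by simp
qed

lemma rshift_conv_lshift: "rshift V X A = lshift (rev_monoidal V) A X"
  by (simp add: rshift_def lshift_def)

lemma rshift_transf_conv_lshift_transf:
  "rshift_transf V Y \<alpha> f = lshift_transf (rev_monoidal V) Y f \<alpha>"
  by (cases \<alpha>) (simp add: rshift_transf_def lshift_transf_def rshift_conv_lshift)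

lemma lshift_simps:
  "B \<in> Obj V \<Longrightarrow> fobj (lshift V A X) B = fobj X (B \<otimes>\<^sub>o\<^bsub>V\<^esub> A)"
  "g \<in> hom V B B' \<Longrightarrow> farr (lshift V A X) g = farr X (g \<otimes>\<^sub>a\<^bsub>V\<^esub> Ide V A)"
  by (simp_all add: lshift_def hom_def)

lemma rshift_simps:
  "B \<in> Obj V \<Longrightarrow> fobj (rshift V X A) B = fobj X (A \<otimes>\<^sub>o\<^bsub>V\<^esub> B)"
  "g \<in> hom V B B' \<Longrightarrow> farr (rshift V X A) g = farr X (Ide V A \<otimes>\<^sub>a\<^bsub>V\<^esub> g)"
  by (simp_all add: rshift_def hom_def)

lemma is_functor_lshift:
  assumes V: "strict_monoidal V" and X: "is_functor V Y X" and A: "A \<in> Obj V"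
  shows "is_functor V Y (lshift V A X)"
proof -
  note v = strict_monoidal_facts[OF V]
  interpret V: category V by (rule v)
  note x = functor_in[OF X]
  have i: "Ide V A \<in> hom V A A" using A by (rule V.Ide_in)
  show ?thesis
    unfolding is_functor_def
  proof (intro conjI allI impI ballI, goal_cases)
    case 3 show ?case using x(3) v(2)[OF _ A] by (auto simp: lshift_def)
  next
    case 4 show ?case by (simp add: lshift_def)
  next
    case (5 B B' g)
    then show ?case using x(4)[OF v(3)[OF 5 i]] V.hom_Obj[OF 5] by (simp add: lshift_simps)
  next
    case (6 B)
    then show ?case
      using A v(2) V.Ide_in[OF 6] by (simp add: lshift_simps v(4) x(5))
  next
    case (7 B B' B'' g g')
    then have g: "g \<in> hom V B B'" and g': "g' \<in> hom V B' B''" by auto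
    have "(g' \<cdot>\<^bsub>V\<^esub> g) \<otimes>\<^sub>a\<^bsub>V\<^esub> Ide V A = (g' \<otimes>\<^sub>a\<^bsub>V\<^esub> Ide V A) \<cdot>\<^bsub>V\<^esub> (g \<otimes>\<^sub>a\<^bsub>V\<^esub> Ide V A)"
      using v(5)[OF g g' i i] V.Ide_Comp[OF i] by simp
    then show ?case
      using x(6)[OF v(3)[OF g i] v(3)[OF g' i]]
      by (simp add: lshift_simps(2)[OF V.Comp_in[OF g g']] lshift_simps(2)[OF g] lshift_simps(2)[OF g'])
  qed (rule x)+
qed

lemma is_functor_rshift:
  "\<lbrakk>strict_monoidal V; is_functor V Y X; A \<in> Obj V\<rbrakk> \<Longrightarrow> is_functor V Y (rshift V X A)"
  using is_functor_lshift[OF strict_monoidal_rev_monoidal] by (simp add: rshift_conv_lshift)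

lemma tensor_slide:
  assumes V: "strict_monoidal V" and f: "f \<in> hom V A A'" and g: "g \<in> hom V B B'"
  shows "(f \<otimes>\<^sub>a\<^bsub>V\<^esub> Ide V B') \<cdot>\<^bsub>V\<^esub> (Ide V A \<otimes>\<^sub>a\<^bsub>V\<^esub> g) = f \<otimes>\<^sub>a\<^bsub>V\<^esub> g"
    "(Ide V A' \<otimes>\<^sub>a\<^bsub>V\<^esub> g) \<cdot>\<^bsub>V\<^esub> (f \<otimes>\<^sub>a\<^bsub>V\<^esub> Ide V B) = f \<otimes>\<^sub>a\<^bsub>V\<^esub> g"
proof -
  note v = strict_monoidal_facts[OF V]
  interpret V: category V by (rule v)
  have "A \<in> Obj V" "A' \<in> Obj V" "B \<in> Obj V" "B' \<in> Obj V"
    using V.hom_Obj[OF f] V.hom_Obj[OF g] by auto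
  note i = this[THEN V.Ide_in]
  show "(f \<otimes>\<^sub>a\<^bsub>V\<^esub> Ide V B') \<cdot>\<^bsub>V\<^esub> (Ide V A \<otimes>\<^sub>a\<^bsub>V\<^esub> g) = f \<otimes>\<^sub>a\<^bsub>V\<^esub> g"
    using v(5)[OF i(1) f g i(4)] by (simp add: V.Comp_Ide[OF f] V.Ide_Comp[OF g])
  show "(Ide V A' \<otimes>\<^sub>a\<^bsub>V\<^esub> g) \<cdot>\<^bsub>V\<^esub> (f \<otimes>\<^sub>a\<^bsub>V\<^esub> Ide V B) = f \<otimes>\<^sub>a\<^bsub>V\<^esub> g"
    using v(5)[OF f i(2) i(3) g] by (simp add: V.Comp_Ide[OF g] V.Ide_Comp[OF f])
qed

abbreviation lcomp ::
  "('a, 'f, 'y) monoidal_cat_scheme \<Rightarrow> ('o, 'm, 'z) category_scheme \<Rightarrow>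
   'f \<Rightarrow> ('a, 'f, 'o, 'm) ftor \<Rightarrow> ('a \<Rightarrow> 'm) \<Rightarrow> 'a \<Rightarrow> 'm"
where
  "lcomp V Y f X \<alpha> \<equiv> \<lambda>B \<in> Obj V. \<alpha> (B \<otimes>\<^sub>o\<^bsub>V\<^esub> Cod V f) \<cdot>\<^bsub>Y\<^esub> farr X (Ide V B \<otimes>\<^sub>a\<^bsub>V\<^esub> f)"

lemma lshift_transf_eq:
  "f \<in> hom V A A' \<Longrightarrow>
    lshift_transf V Y f (X, X', \<alpha>) = (lshift V A X, lshift V A' X', lcomp V Y f X \<alpha>)"
  by (simp add: lshift_transf_def hom_def)

lemma rshift_transf_eq:
  "f \<in> hom V A A' \<Longrightarrow>
    rshift_transf V Y (X, X', \<alpha>) f = (rshift V X A, rshift V X' A', lcomp (rev_monoidal V) Y f X \<alpha>)"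
  by (simp add: rshift_transf_def hom_def)

lemma natural_transformation_lcomp:
  assumes V: "strict_monoidal V" and a: "natural_transformation V Y X X' \<alpha>" and f: "f \<in> hom V A A'"
  shows "natural_transformation V Y (lshift V A X) (lshift V A' X') (lcomp V Y f X \<alpha>)"
proof -
  note v = strict_monoidal_facts[OF V]
  note a' = natural_transformation_in[OF a]
  note x = functor_in[OF a'(1)]
  note x' = functor_in[OF a'(2)]
  interpret V: category V by (rule v)
  interpret Y: category Y by (rule x)
  have A: "A \<in> Obj V" "A' \<in> Obj V" using V.hom_Obj[OF f] by auto
  note i = A[THEN V.Ide_in]
  have cf: "Cod V f = A'" using f by (simp add: hom_def)
  have m: "farr X (Ide V B \<otimes>\<^sub>a\<^bsub>V\<^esub> f) \<in> hom Y (fobj X (B \<otimes>\<^sub>o\<^bsub>V\<^esub> A)) (fobj X (B \<otimes>\<^sub>o\<^bsub>V\<^esub> A'))"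
    if "B \<in> Obj V" for B
    using x(4)[OF v(3)[OF V.Ide_in[OF that] f]] .
  show ?thesis
    unfolding natural_transformation_def
  proof (intro conjI allI impI ballI, goal_cases)
    case 1 show ?case by (rule is_functor_lshift[OF V a'(1) A(1)])
  next
    case 2 show ?case by (rule is_functor_lshift[OF V a'(2) A(2)])
  next
    case 3 show ?case by simp
  next
    case (4 B)
    show ?case
      using 4 Y.Comp_in[OF m[OF 4] a'(4)[OF v(2)[OF 4 A(2)]]] by (simp add: lshift_simps cf)
  next
    case (5 B B' g)
    have B: "B \<in> Obj V" "B' \<in> Obj V" using V.hom_Obj[OF 5] by auto
    note gi = v(3)[OF 5 i(1)] and gi' = v(3)[OF 5 i(2)]
    note jf = v(3)[OF V.Ide_in[OF B(1)] f] and jf' = v(3)[OF V.Ide_in[OF B(2)] f]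
    have "farr X' (g \<otimes>\<^sub>a\<^bsub>V\<^esub> Ide V A') \<cdot>\<^bsub>Y\<^esub> (\<alpha> (B \<otimes>\<^sub>o\<^bsub>V\<^esub> A') \<cdot>\<^bsub>Y\<^esub> farr X (Ide V B \<otimes>\<^sub>a\<^bsub>V\<^esub> f))
      = (farr X' (g \<otimes>\<^sub>a\<^bsub>V\<^esub> Ide V A') \<cdot>\<^bsub>Y\<^esub> \<alpha> (B \<otimes>\<^sub>o\<^bsub>V\<^esub> A')) \<cdot>\<^bsub>Y\<^esub> farr X (Ide V B \<otimes>\<^sub>a\<^bsub>V\<^esub> f)"
      by (rule Y.Comp_assoc[OF m[OF B(1)] a'(4)[OF v(2)[OF B(1) A(2)]] x'(4)[OF gi'], symmetric])
    also have "\<dots> = (\<alpha> (B' \<otimes>\<^sub>o\<^bsub>V\<^esub> A') \<cdot>\<^bsub>Y\<^esub> farr X (g \<otimes>\<^sub>a\<^bsub>V\<^esub> Ide V A')) \<cdot>\<^bsub>Y\<^esub> farr X (Ide V B \<otimes>\<^sub>a\<^bsub>V\<^esub> f)"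
      by (simp add: a'(5)[OF gi'])
    also have "\<dots> = \<alpha> (B' \<otimes>\<^sub>o\<^bsub>V\<^esub> A') \<cdot>\<^bsub>Y\<^esub> (farr X (g \<otimes>\<^sub>a\<^bsub>V\<^esub> Ide V A') \<cdot>\<^bsub>Y\<^esub> farr X (Ide V B \<otimes>\<^sub>a\<^bsub>V\<^esub> f))"
      by (rule Y.Comp_assoc[OF m[OF B(1)] x(4)[OF gi'] a'(4)[OF v(2)[OF B(2) A(2)]]])
    also have "farr X (g \<otimes>\<^sub>a\<^bsub>V\<^esub> Ide V A') \<cdot>\<^bsub>Y\<^esub> farr X (Ide V B \<otimes>\<^sub>a\<^bsub>V\<^esub> f)
      = farr X (Ide V B' \<otimes>\<^sub>a\<^bsub>V\<^esub> f) \<cdot>\<^bsub>Y\<^esub> farr X (g \<otimes>\<^sub>a\<^bsub>V\<^esub> Ide V A)"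
      using x(6)[OF jf gi'] x(6)[OF gi jf'] tensor_slide[OF V 5 f] by simp
    also have "\<alpha> (B' \<otimes>\<^sub>o\<^bsub>V\<^esub> A') \<cdot>\<^bsub>Y\<^esub> (farr X (Ide V B' \<otimes>\<^sub>a\<^bsub>V\<^esub> f) \<cdot>\<^bsub>Y\<^esub> farr X (g \<otimes>\<^sub>a\<^bsub>V\<^esub> Ide V A))
      = (\<alpha> (B' \<otimes>\<^sub>o\<^bsub>V\<^esub> A') \<cdot>\<^bsub>Y\<^esub> farr X (Ide V B' \<otimes>\<^sub>a\<^bsub>V\<^esub> f)) \<cdot>\<^bsub>Y\<^esub> farr X (g \<otimes>\<^sub>a\<^bsub>V\<^esub> Ide V A)"
      by (rule Y.Comp_assoc[OF x(4)[OF gi] m[OF B(2)] a'(4)[OF v(2)[OF B(2) A(2)]], symmetric])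
    finally show ?case
      using B by (simp add: lshift_simps(2)[OF 5] cf)
  qed
qed

lemma natural_transformation_rcomp:
  "\<lbrakk>strict_monoidal V; natural_transformation V Y X X' \<alpha>; f \<in> hom V A A'\<rbrakk>
    \<Longrightarrow> natural_transformation V Y (rshift V X A) (rshift V X' A') (lcomp (rev_monoidal V) Y f X \<alpha>)"
  using natural_transformation_lcomp[OF strict_monoidal_rev_monoidal, of V Y X X' \<alpha> f A A']
  by (simp add: rshift_conv_lshift)

lemma lshift_transf_in:
  assumes V: "strict_monoidal V" and f: "f \<in> hom V A A'" and p: "p \<in> hom (fun_cat V Y) X X'"
  shows "lshift_transf V Y f p \<in> hom (fun_cat V Y) (lshift V A X) (lshift V A' X')"
  using p natural_transformation_lcomp[OF V _ f]
  by (auto simp: hom_fun_cat lshift_transf_eq[OF f])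

lemma lshift_transf_Ide:
  assumes V: "strict_monoidal V" and A: "A \<in> Obj V" and X: "is_functor V Y X"
  shows "lshift_transf V Y (Ide V A) (Ide (fun_cat V Y) X) = Ide (fun_cat V Y) (lshift V A X)"
proof -
  note v = strict_monoidal_facts[OF V]
  note x = functor_in[OF X]
  interpret V: category V by (rule v)
  interpret Y: category Y by (rule x)
  note i = V.Ide_in[OF A]
  have "Cod V (Ide V A) = A" using i by (simp add: hom_def)
  then show ?thesis
    using v(2)[OF _ A] Y.Ide_in x(3)
    by (auto simp: fun_cat_simps lshift_transf_eq[OF i] lshift_simps fun_eq_iff v(4) x(5) A
        intro!: Y.Ide_Comp)
qed

lemma lshift_transf_Comp:
  assumes V: "strict_monoidal V" and f: "f \<in> hom V A A'" and f': "f' \<in> hom V A' A''"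
    and p: "p \<in> hom (fun_cat V Y) X X'" and p': "p' \<in> hom (fun_cat V Y) X' X''"
  shows "lshift_transf V Y (f' \<cdot>\<^bsub>V\<^esub> f) (p' \<cdot>\<^bsub>fun_cat V Y\<^esub> p) =
    lshift_transf V Y f' p' \<cdot>\<^bsub>fun_cat V Y\<^esub> lshift_transf V Y f p"
proof -
  note v = strict_monoidal_facts[OF V]
  obtain \<alpha> \<alpha>' where e: "p = (X, X', \<alpha>)" "p' = (X', X'', \<alpha>')"
    and a: "natural_transformation V Y X X' \<alpha>" and b: "natural_transformation V Y X' X'' \<alpha>'"
    using p p' by (auto simp: hom_fun_cat)
  note a' = natural_transformation_in[OF a]
  note b' = natural_transformation_in[OF b]
  note x = functor_in[OF a'(1)]
  note x' = functor_in[OF a'(2)]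
  interpret V: category V by (rule v)
  interpret Y: category Y by (rule x)
  note ff = V.Comp_in[OF f f']
  have A: "A \<in> Obj V" "A' \<in> Obj V" "A'' \<in> Obj V" using V.hom_Obj[OF f] V.hom_Obj[OF f'] by auto
  have c: "Cod V f = A'" "Cod V f' = A''" "Cod V (f' \<cdot>\<^bsub>V\<^esub> f) = A''"
    using f f' ff by (simp_all add: hom_def)
  have "(\<alpha>' (B \<otimes>\<^sub>o\<^bsub>V\<^esub> A'') \<cdot>\<^bsub>Y\<^esub> \<alpha> (B \<otimes>\<^sub>o\<^bsub>V\<^esub> A'')) \<cdot>\<^bsub>Y\<^esub> farr X (Ide V B \<otimes>\<^sub>a\<^bsub>V\<^esub> (f' \<cdot>\<^bsub>V\<^esub> f)) =
    (\<alpha>' (B \<otimes>\<^sub>o\<^bsub>V\<^esub> A'') \<cdot>\<^bsub>Y\<^esub> farr X' (Ide V B \<otimes>\<^sub>a\<^bsub>V\<^esub> f')) \<cdot>\<^bsub>Y\<^esub>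
      (\<alpha> (B \<otimes>\<^sub>o\<^bsub>V\<^esub> A') \<cdot>\<^bsub>Y\<^esub> farr X (Ide V B \<otimes>\<^sub>a\<^bsub>V\<^esub> f))"
    (is "(?r \<cdot>\<^bsub>Y\<^esub> ?s) \<cdot>\<^bsub>Y\<^esub> farr X (_ \<otimes>\<^sub>a\<^bsub>V\<^esub> _) = (_ \<cdot>\<^bsub>Y\<^esub> ?u) \<cdot>\<^bsub>Y\<^esub> (?t \<cdot>\<^bsub>Y\<^esub> ?w)")
    if B: "B \<in> Obj V" for B
  proof -
    note j = V.Ide_in[OF B]
    let ?u' = "farr X (Ide V B \<otimes>\<^sub>a\<^bsub>V\<^esub> f')"
    note w = x(4)[OF v(3)[OF j f]] and u' = x(4)[OF v(3)[OF j f']] and u = x'(4)[OF v(3)[OF j f']]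
    note t = a'(4)[OF v(2)[OF B A(2)]] and s = a'(4)[OF v(2)[OF B A(3)]]
      and r = b'(4)[OF v(2)[OF B A(3)]]
    have "Ide V B \<otimes>\<^sub>a\<^bsub>V\<^esub> (f' \<cdot>\<^bsub>V\<^esub> f) = (Ide V B \<otimes>\<^sub>a\<^bsub>V\<^esub> f') \<cdot>\<^bsub>V\<^esub> (Ide V B \<otimes>\<^sub>a\<^bsub>V\<^esub> f)"
      using v(5)[OF j j f f'] by (simp add: V.Ide_Comp[OF j])
    then have "(?r \<cdot>\<^bsub>Y\<^esub> ?s) \<cdot>\<^bsub>Y\<^esub> farr X (Ide V B \<otimes>\<^sub>a\<^bsub>V\<^esub> (f' \<cdot>\<^bsub>V\<^esub> f)) = (?r \<cdot>\<^bsub>Y\<^esub> ?s) \<cdot>\<^bsub>Y\<^esub> (?u' \<cdot>\<^bsub>Y\<^esub> ?w)"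
      using x(6)[OF v(3)[OF j f] v(3)[OF j f']] by simp
    also have "\<dots> = ?r \<cdot>\<^bsub>Y\<^esub> ((?s \<cdot>\<^bsub>Y\<^esub> ?u') \<cdot>\<^bsub>Y\<^esub> ?w)"
      using Y.Comp_assoc[OF Y.Comp_in[OF w u'] s r] Y.Comp_assoc[OF w u' s] by simp
    also have "?s \<cdot>\<^bsub>Y\<^esub> ?u' = ?u \<cdot>\<^bsub>Y\<^esub> ?t"
      by (rule a'(5)[OF v(3)[OF j f'], symmetric])
    also have "?r \<cdot>\<^bsub>Y\<^esub> ((?u \<cdot>\<^bsub>Y\<^esub> ?t) \<cdot>\<^bsub>Y\<^esub> ?w) = (?r \<cdot>\<^bsub>Y\<^esub> ?u) \<cdot>\<^bsub>Y\<^esub> (?t \<cdot>\<^bsub>Y\<^esub> ?w)"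
      using Y.Comp_assoc[OF Y.Comp_in[OF w t] u r] Y.Comp_assoc[OF w t u] by simp
    finally show ?thesis .
  qed
  then show ?thesis
    using v(2)[OF _ A(3)]
    by (simp add: e fun_cat_simps lshift_transf_eq[OF f] lshift_transf_eq[OF f'] lshift_transf_eq[OF ff]
        c fun_eq_iff)
qed

lemma lshift_Unit:
  assumes V: "strict_monoidal V" and X: "is_functor V Y X"
  shows "lshift V (Unit V) X = X"
  by (rule ftor_eqI[OF is_functor_lshift[OF V X] X])
    (auto simp: lshift_simps strict_monoidal_facts[OF V])

lemma lshift_tensor:
  assumes V: "strict_monoidal V" and X: "is_functor V Y X" and A: "A \<in> Obj V" and B: "B \<in> Obj V"
  shows "lshift V (A \<otimes>\<^sub>o\<^bsub>V\<^esub> B) X = lshift V A (lshift V B X)"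
proof -
  note v = strict_monoidal_facts[OF V]
  interpret V: category V by (rule v)
  note i = V.Ide_in[OF A] V.Ide_in[OF B]
  show ?thesis
  proof (rule ftor_eqI)
    show "is_functor V Y (lshift V (A \<otimes>\<^sub>o\<^bsub>V\<^esub> B) X)" "is_functor V Y (lshift V A (lshift V B X))"
      by (intro is_functor_lshift[OF V] X v(2) A B)+
    show "E \<in> Obj V \<Longrightarrow> fobj (lshift V (A \<otimes>\<^sub>o\<^bsub>V\<^esub> B) X) E = fobj (lshift V A (lshift V B X)) E" for E
      by (simp add: lshift_simps v(2,11) A B)
    show "farr (lshift V (A \<otimes>\<^sub>o\<^bsub>V\<^esub> B) X) f = farr (lshift V A (lshift V B X)) f"
      if f: "f \<in> hom V E E'" for f E E'
      using v(12)[OF f i] v(4)[OF A B]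
      by (simp add: lshift_simps(2)[OF f] lshift_simps(2)[OF v(3)[OF f i(1)]])
  qed
qed

lemma lshift_transf_Unit:
  assumes V: "strict_monoidal V" and p: "p \<in> hom (fun_cat V Y) X X'"
  shows "lshift_transf V Y (Ide V (Unit V)) p = p"
proof -
  note v = strict_monoidal_facts[OF V]
  obtain \<alpha> where e: "p = (X, X', \<alpha>)" and a: "natural_transformation V Y X X' \<alpha>"
    using p by (auto simp: hom_fun_cat)
  note a' = natural_transformation_in[OF a]
  note x = functor_in[OF a'(1)]
  interpret V: category V by (rule v)
  interpret Y: category Y by (rule x)
  note i = V.Ide_in[OF v(6)]
  have "Cod V (Ide V (Unit V)) = Unit V" using i by (simp add: hom_def)
  then have "lcomp V Y (Ide V (Unit V)) X \<alpha> = \<alpha>"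
    using a'(3) v(10)[OF V.Ide_in] Y.Comp_Ide[OF a'(4)]
    by (auto simp: fun_eq_iff extensional_def v x)
  then show ?thesis
    by (simp add: e lshift_transf_eq[OF i] lshift_Unit[OF V a'(1)] lshift_Unit[OF V a'(2)])
qed

lemma lshift_transf_tensor:
  assumes V: "strict_monoidal V" and f: "f \<in> hom V A A'" and g: "g \<in> hom V B B'"
    and p: "p \<in> hom (fun_cat V Y) X X'"
  shows "lshift_transf V Y (f \<otimes>\<^sub>a\<^bsub>V\<^esub> g) p = lshift_transf V Y f (lshift_transf V Y g p)"
proof -
  note v = strict_monoidal_facts[OF V]
  obtain \<alpha> where e: "p = (X, X', \<alpha>)" and a: "natural_transformation V Y X X' \<alpha>"
    using p by (auto simp: hom_fun_cat)
  note a' = natural_transformation_in[OF a]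
  note x = functor_in[OF a'(1)]
  interpret V: category V by (rule v)
  interpret Y: category Y by (rule x)
  have A: "A \<in> Obj V" "A' \<in> Obj V" "B \<in> Obj V" "B' \<in> Obj V"
    using V.hom_Obj[OF f] V.hom_Obj[OF g] by auto
  note fg = v(3)[OF f g]
  have c: "Cod V f = A'" "Cod V g = B'" "Cod V (f \<otimes>\<^sub>a\<^bsub>V\<^esub> g) = A' \<otimes>\<^sub>o\<^bsub>V\<^esub> B'"
    using f g fg by (simp_all add: hom_def)
  have "\<alpha> (E \<otimes>\<^sub>o\<^bsub>V\<^esub> A' \<otimes>\<^sub>o\<^bsub>V\<^esub> B') \<cdot>\<^bsub>Y\<^esub> farr X (Ide V E \<otimes>\<^sub>a\<^bsub>V\<^esub> f \<otimes>\<^sub>a\<^bsub>V\<^esub> g) =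
      (\<alpha> ((E \<otimes>\<^sub>o\<^bsub>V\<^esub> A') \<otimes>\<^sub>o\<^bsub>V\<^esub> B') \<cdot>\<^bsub>Y\<^esub> farr X (Ide V (E \<otimes>\<^sub>o\<^bsub>V\<^esub> A') \<otimes>\<^sub>a\<^bsub>V\<^esub> g)) \<cdot>\<^bsub>Y\<^esub>
        farr (lshift V B X) (Ide V E \<otimes>\<^sub>a\<^bsub>V\<^esub> f)"
    if E: "E \<in> Obj V" for E
  proof -
    note j = V.Ide_in[OF E]
    note EA = v(2)[OF E A(2)]
    note jf = v(3)[OF j f]
    note m1 = v(3)[OF jf V.Ide_in[OF A(3)]] and m2 = v(3)[OF V.Ide_in[OF EA] g]
    have "farr X (Ide V E \<otimes>\<^sub>a\<^bsub>V\<^esub> f \<otimes>\<^sub>a\<^bsub>V\<^esub> g) =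
      farr X (Ide V (E \<otimes>\<^sub>o\<^bsub>V\<^esub> A') \<otimes>\<^sub>a\<^bsub>V\<^esub> g) \<cdot>\<^bsub>Y\<^esub> farr X ((Ide V E \<otimes>\<^sub>a\<^bsub>V\<^esub> f) \<otimes>\<^sub>a\<^bsub>V\<^esub> Ide V B)"
      using x(6)[OF m1 m2] tensor_slide(2)[OF V jf g] v(12)[OF j f g] by simp
    then show ?thesis
      using Y.Comp_assoc[OF x(4)[OF m1] x(4)[OF m2] a'(4)[OF v(2)[OF EA A(4)]]]
      by (simp add: lshift_simps(2)[OF jf] v(11) E A)
  qed
  then show ?thesis
    using v(2)[OF _ A(2)]
    by (simp add: e lshift_transf_eq[OF f] lshift_transf_eq[OF g] lshift_transf_eq[OF fg] c fun_eq_iff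
        lshift_tensor[OF V a'(1) A(1,3)] lshift_tensor[OF V a'(2) A(2,4)])
qed

lemma lshift_rshift:
  assumes V: "strict_monoidal V" and X: "is_functor V Y X" and A: "A \<in> Obj V" and B: "B \<in> Obj V"
  shows "lshift V A (rshift V X B) = rshift V (lshift V A X) B"
proof -
  note v = strict_monoidal_facts[OF V]
  interpret V: category V by (rule v)
  note i = V.Ide_in[OF A] V.Ide_in[OF B]
  show ?thesis
  proof (rule ftor_eqI)
    show "is_functor V Y (lshift V A (rshift V X B))" "is_functor V Y (rshift V (lshift V A X) B)"
      by (intro is_functor_lshift[OF V] is_functor_rshift[OF V] X A B)+
    show "E \<in> Obj V \<Longrightarrow> fobj (lshift V A (rshift V X B)) E = fobj (rshift V (lshift V A X) B) E" for E
      by (simp add: lshift_simps rshift_simps v(2,11) A B)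
    show "farr (lshift V A (rshift V X B)) f = farr (rshift V (lshift V A X) B) f"
      if f: "f \<in> hom V E E'" for f E E'
      using v(12)[OF i(2) f i(1)]
      by (simp add: lshift_simps(2)[OF f] rshift_simps(2)[OF f] rshift_simps(2)[OF v(3)[OF f i(1)]]
          lshift_simps(2)[OF v(3)[OF i(2) f]])
  qed
qed

lemma lshift_rshift_transf:
  assumes V: "strict_monoidal V" and f: "f \<in> hom V A A'" and g: "g \<in> hom V B B'"
    and p: "p \<in> hom (fun_cat V Y) X X'"
  shows "lshift_transf V Y f (rshift_transf V Y p g) = rshift_transf V Y (lshift_transf V Y f p) g"
proof -
  note v = strict_monoidal_facts[OF V]
  obtain \<alpha> where e: "p = (X, X', \<alpha>)" and a: "natural_transformation V Y X X' \<alpha>"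
    using p by (auto simp: hom_fun_cat)
  note a' = natural_transformation_in[OF a]
  note x = functor_in[OF a'(1)]
  interpret V: category V by (rule v)
  interpret Y: category Y by (rule x)
  have A: "A \<in> Obj V" "A' \<in> Obj V" "B \<in> Obj V" "B' \<in> Obj V"
    using V.hom_Obj[OF f] V.hom_Obj[OF g] by auto
  have c: "Cod V f = A'" "Cod V g = B'" using f g by (simp_all add: hom_def)
  have "(\<alpha> (B' \<otimes>\<^sub>o\<^bsub>V\<^esub> E \<otimes>\<^sub>o\<^bsub>V\<^esub> A') \<cdot>\<^bsub>Y\<^esub> farr X (g \<otimes>\<^sub>a\<^bsub>V\<^esub> Ide V (E \<otimes>\<^sub>o\<^bsub>V\<^esub> A'))) \<cdot>\<^bsub>Y\<^esub>
        farr (rshift V X B) (Ide V E \<otimes>\<^sub>a\<^bsub>V\<^esub> f) =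
      (\<alpha> ((B' \<otimes>\<^sub>o\<^bsub>V\<^esub> E) \<otimes>\<^sub>o\<^bsub>V\<^esub> A') \<cdot>\<^bsub>Y\<^esub> farr X (Ide V (B' \<otimes>\<^sub>o\<^bsub>V\<^esub> E) \<otimes>\<^sub>a\<^bsub>V\<^esub> f)) \<cdot>\<^bsub>Y\<^esub>
        farr (lshift V A X) (g \<otimes>\<^sub>a\<^bsub>V\<^esub> Ide V E)"
    if E: "E \<in> Obj V" for E
  proof -
    note j = V.Ide_in[OF E]
    note EA = v(2)[OF E A(2)] and BE = v(2)[OF A(4) E]
    note jf = v(3)[OF j f] and gj = v(3)[OF g j]
    note m1 = v(3)[OF g V.Ide_in[OF EA]] and m2 = v(3)[OF V.Ide_in[OF A(3)] jf]
    note n1 = v(3)[OF V.Ide_in[OF BE] f] and n2 = v(3)[OF gj V.Ide_in[OF A(1)]]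
    have "farr X (g \<otimes>\<^sub>a\<^bsub>V\<^esub> Ide V (E \<otimes>\<^sub>o\<^bsub>V\<^esub> A')) \<cdot>\<^bsub>Y\<^esub> farr X (Ide V B \<otimes>\<^sub>a\<^bsub>V\<^esub> Ide V E \<otimes>\<^sub>a\<^bsub>V\<^esub> f) =
      farr X (Ide V (B' \<otimes>\<^sub>o\<^bsub>V\<^esub> E) \<otimes>\<^sub>a\<^bsub>V\<^esub> f) \<cdot>\<^bsub>Y\<^esub> farr X ((g \<otimes>\<^sub>a\<^bsub>V\<^esub> Ide V E) \<otimes>\<^sub>a\<^bsub>V\<^esub> Ide V A)"
      using x(6)[OF m2 m1] x(6)[OF n2 n1] tensor_slide(1)[OF V g jf] tensor_slide(2)[OF V gj f]
        v(12)[OF g j f] by simp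
    then show ?thesis
      using Y.Comp_assoc[OF x(4)[OF m2] x(4)[OF m1] a'(4)[OF v(2)[OF A(4) EA]]]
        Y.Comp_assoc[OF x(4)[OF n2] x(4)[OF n1] a'(4)[OF v(2)[OF BE A(2)]]]
      by (simp add: lshift_simps(2)[OF gj] rshift_simps(2)[OF jf] v(11) E A)
  qed
  then show ?thesis
    using v(2)[OF _ A(2)] v(2)[OF A(4)]
    by (simp add: e lshift_transf_eq[OF f] rshift_transf_eq[OF g] c fun_eq_iff
        lshift_rshift[OF V a'(1) A(1,3)] lshift_rshift[OF V a'(2) A(2,4)])
qed

lemma shift_bimodule_simps:
  "Under (shift_bimodule V Y) = fun_cat V Y"
  "\<lbrakk>A \<in> Obj V; X \<in> Obj (fun_cat V Y)\<rbrakk> \<Longrightarrow> A \<rhd>\<^sub>o\<^bsub>shift_bimodule V Y\<^esub> X = lshift V A X"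
  "\<lbrakk>A \<in> Obj V; X \<in> Obj (fun_cat V Y)\<rbrakk> \<Longrightarrow> X \<lhd>\<^sub>o\<^bsub>shift_bimodule V Y\<^esub> A = rshift V X A"
  "\<lbrakk>f \<in> Arr V; p \<in> Arr (fun_cat V Y)\<rbrakk> \<Longrightarrow> f \<rhd>\<^sub>a\<^bsub>shift_bimodule V Y\<^esub> p = lshift_transf V Y f p"
  "\<lbrakk>f \<in> Arr V; p \<in> Arr (fun_cat V Y)\<rbrakk> \<Longrightarrow> p \<lhd>\<^sub>a\<^bsub>shift_bimodule V Y\<^esub> f = rshift_transf V Y p f"
  "Chi (shift_bimodule V Y) A X B = Ide (fun_cat V Y) (lshift V A (rshift V X B))"
  by (simp_all add: shift_bimodule_def)

theorem strict_bimodule_shift_bimodule: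
  assumes V: "strict_monoidal V" and Y: "category Y"
  shows "strict_bimodule V (shift_bimodule V Y)"
proof -
  let ?M = "shift_bimodule V Y"
  let ?F = "fun_cat V Y"
  note v = strict_monoidal_facts[OF V]
  note R = strict_monoidal_rev_monoidal[OF V]
  interpret V: category V by (rule v)
  interpret F: category ?F using v(1) Y by (rule category_fun_cat)
  note r = rshift_conv_lshift rshift_transf_conv_lshift_transf
  have V_in: "f \<in> hom V (Dom V f) (Cod V f)" if "f \<in> Arr V" for f using that by (simp add: hom_def)
  have F_in: "p \<in> hom ?F (Dom ?F p) (Cod ?F p)" if "p \<in> Arr ?F" for p using that by (simp add: hom_def)
  have VA: "f \<in> hom V A B \<Longrightarrow> f \<in> Arr V" and FA: "p \<in> hom ?F X X' \<Longrightarrow> p \<in> Arr ?F" for f A B p X X'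
    by (simp_all add: hom_def)
  have FO: "X \<in> Obj ?F \<longleftrightarrow> is_functor V Y X" for X by (simp add: fun_cat_simps)
  have lo: "lshift V A X \<in> Obj ?F" and ro: "rshift V X A \<in> Obj ?F"
    if "A \<in> Obj V" "X \<in> Obj ?F" for A X
    using that by (auto simp: FO is_functor_lshift[OF V] is_functor_rshift[OF V])
  have la: "lshift_transf V Y f p \<in> hom ?F (lshift V A X) (lshift V A' X')"
    and ra: "rshift_transf V Y p f \<in> hom ?F (rshift V X A) (rshift V X' A')"
    if "f \<in> hom V A A'" "p \<in> hom ?F X X'" for f p A A' X X'
    using lshift_transf_in[OF V that] lshift_transf_in[OF R, of f A A' p Y X X'] that by (simp_all add: r)
  have laA: "lshift_transf V Y f p \<in> Arr ?F" and raA: "rshift_transf V Y p f \<in> Arr ?F"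
    if "f \<in> Arr V" "p \<in> Arr ?F" for f p
    using la[OF V_in[OF that(1)] F_in[OF that(2)]] ra[OF V_in[OF that(1)] F_in[OF that(2)]]
    by (simp_all add: FA)
  have lide: "lshift_transf V Y (Ide V A) (Ide ?F X) = Ide ?F (lshift V A X)"
    and ride: "rshift_transf V Y (Ide ?F X) (Ide V A) = Ide ?F (rshift V X A)"
    if "A \<in> Obj V" "X \<in> Obj ?F" for A X
    using that lshift_transf_Ide[OF V, of A Y X] lshift_transf_Ide[OF R, of A Y X] by (simp_all add: FO r)
  have ideA: "A \<in> Obj V \<Longrightarrow> Ide V A \<in> Arr V" "X \<in> Obj ?F \<Longrightarrow> Ide ?F X \<in> Arr ?F" for A X
    using V.Ide_in VA F.Ide_in FA by blast+
  have tA: "f \<in> Arr V \<Longrightarrow> g \<in> Arr V \<Longrightarrow> f \<otimes>\<^sub>a\<^bsub>V\<^esub> g \<in> Arr V" for f g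
    using v(3)[OF V_in V_in] VA by blast
  have lr: "lshift V A (rshift V X B) = rshift V (lshift V A X) B"
    if "A \<in> Obj V" "B \<in> Obj V" "X \<in> Obj ?F" for A B X
    using lshift_rshift[OF V] that by (simp add: FO)
  have lt: "lshift V (A \<otimes>\<^sub>o\<^bsub>V\<^esub> B) X = lshift V A (lshift V B X)"
    and rt: "rshift V X (A \<otimes>\<^sub>o\<^bsub>V\<^esub> B) = rshift V (rshift V X A) B"
    if "A \<in> Obj V" "B \<in> Obj V" "X \<in> Obj ?F" for A B X
    using lshift_tensor[OF V, of Y X A B] lshift_tensor[OF R, of Y X B A] that by (simp_all add: FO r)
  have lta: "lshift_transf V Y (f \<otimes>\<^sub>a\<^bsub>V\<^esub> g) p = lshift_transf V Y f (lshift_transf V Y g p)"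
    and rta: "rshift_transf V Y p (f \<otimes>\<^sub>a\<^bsub>V\<^esub> g) = rshift_transf V Y (rshift_transf V Y p f) g"
    if "f \<in> Arr V" "g \<in> Arr V" "p \<in> Arr ?F" for f g p
    using lshift_transf_tensor[OF V V_in V_in F_in, of f g p]
      lshift_transf_tensor[OF R, of g "Dom V g" "Cod V g" f "Dom V f" "Cod V f" p Y "Dom ?F p" "Cod ?F p"]
      V_in F_in that
    by (simp_all add: r)
  have lu: "lshift V (Unit V) X = X" and ru: "rshift V X (Unit V) = X" if "X \<in> Obj ?F" for X
    using lshift_Unit[OF V, of Y X] lshift_Unit[OF R, of Y X] that by (simp_all add: FO r)
  have lua: "lshift_transf V Y (Ide V (Unit V)) p = p" and rua: "rshift_transf V Y p (Ide V (Unit V)) = p"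
    if "p \<in> Arr ?F" for p
    using lshift_transf_Unit[OF V F_in[OF that]]
      lshift_transf_Unit[OF R, of p Y "Dom ?F p" "Cod ?F p"] F_in[OF that]
    by (simp_all add: r)
  note s = shift_bimodule_simps
  have FI: "Ide ?F X \<cdot>\<^bsub>?F\<^esub> Ide ?F X = Ide ?F X" if "X \<in> Obj ?F" for X
    by (rule F.Comp_Ide[OF F.Ide_in[OF that]])
  have L: "is_functor (prod_cat V ?F) ?F (LAct ?M)"
  proof (rule is_functor_prod_catI, goal_cases)
    case 4 show ?case by (auto simp: shift_bimodule_def lo)
  next
    case 5 show ?case by (simp add: shift_bimodule_def)
  next
    case (6 f p A A' X X')
    then show ?case
      using V.hom_Obj[OF 6(1)] F.hom_Obj[OF 6(2)] by (simp add: s VA FA la)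
  next
    case (7 A X) then show ?case by (simp add: s ideA lide)
  next
    case (8 f p f' p' A A' A'' X X' X'')
    then show ?case
      using VA[OF V.Comp_in[OF 8(1,2)]] FA[OF F.Comp_in[OF 8(3,4)]] lshift_transf_Comp[OF V 8]
      by (simp add: s VA FA)
  qed (rule V.category_axioms F.category_axioms)+
  have Rf: "is_functor (prod_cat ?F V) ?F (RAct ?M)"
  proof (rule is_functor_prod_catI, goal_cases)
    case 4 show ?case by (auto simp: shift_bimodule_def ro)
  next
    case 5 show ?case by (simp add: shift_bimodule_def)
  next
    case (6 p f X X' A A')
    then show ?case
      using V.hom_Obj[OF 6(2)] F.hom_Obj[OF 6(1)] by (simp add: s VA FA ra)
  next
    case (7 X A) then show ?case by (simp add: s ideA ride)
  next
    case (8 p f p' f' X X' X'' A A' A'')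
    then show ?case
      using VA[OF V.Comp_in[OF 8(3,4)]] FA[OF F.Comp_in[OF 8(1,2)]]
        lshift_transf_Comp[OF R, of f A A' f' A'' p Y X X' p' X'']
      by (simp add: s VA FA r)
  qed (rule V.category_axioms F.category_axioms)+
  have chi: "((f \<rhd>\<^sub>a\<^bsub>?M\<^esub> p) \<lhd>\<^sub>a\<^bsub>?M\<^esub> g) \<cdot>\<^bsub>?F\<^esub> Chi ?M (Dom V f) (Dom ?F p) (Dom V g) =
      Chi ?M (Cod V f) (Cod ?F p) (Cod V g) \<cdot>\<^bsub>?F\<^esub> (f \<rhd>\<^sub>a\<^bsub>?M\<^esub> (p \<lhd>\<^sub>a\<^bsub>?M\<^esub> g))"
    if f: "f \<in> Arr V" and p: "p \<in> Arr ?F" and g: "g \<in> Arr V" for f p g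
  proof -
    let ?q = "lshift_transf V Y f (rshift_transf V Y p g)"
    have q: "?q \<in> hom ?F (lshift V (Dom V f) (rshift V (Dom ?F p) (Dom V g)))
        (lshift V (Cod V f) (rshift V (Cod ?F p) (Cod V g)))"
      by (intro la ra V_in F_in f p g)
    show ?thesis
      using F.Comp_Ide[OF q] F.Ide_Comp[OF q] lshift_rshift_transf[OF V V_in V_in F_in, OF f g p]
      by (simp add: s f p g laA raA)
  qed
  show ?thesis
    unfolding strict_bimodule_def s(1)
  proof (intro conjI ballI, goal_cases)
    case 1 show ?case by (rule V)
  next
    case 2 show ?case by (rule L)
  next
    case 3 show ?case by (rule Rf)
  next
    case (12 A X B) then show ?case using F.Ide_in[OF lo[OF _ ro]] by (simp add: s lo ro lr)
  next
    case (13 f p g) then show ?case by (rule chi)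
  qed (simp_all add: s v(2,6) lo ro lu ru lt rt ideA tA laA raA lua rua lta rta lide ride lr FI)
qed

corollary strict_bimodule_Delta_plus_op:
  "category Y \<Longrightarrow> strict_bimodule Delta_plus_op (shift_bimodule Delta_plus_op Y)"
  by (intro strict_bimodule_shift_bimodule strict_monoidal_op_monoidal strict_monoidal_Delta_plus)

text \<open>The actions of the one-element ordinal \<open>1\<close> are the two decalage functors: \<open>1 \<rhd> X\<close>
  shifts \<open>X\<close> and discards the last faces and degeneracies, \<open>X \<lhd> 1\<close> discards the zeroth ones.
  The discarded operators are the components of the actions of the counit \<open>1 \<rightarrow> 0\<close> and of
  the comultiplication \<open>1 \<rightarrow> 1 \<otimes> 1\<close> of the comonoid \<open>1\<close> in \<open>Delta_plus_op\<close>, and the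
  compatibility (the distributive law) is the identity.\<close>

lemma op_monoidal_simps:
  "Obj (op_monoidal V) = Obj V" "Arr (op_monoidal V) = Arr V"
  "Dom (op_monoidal V) = Cod V" "Cod (op_monoidal V) = Dom V"
  "Ide (op_monoidal V) = Ide V" "Tensor (op_monoidal V) = Tensor V" "Unit (op_monoidal V) = Unit V"
  "g \<cdot>\<^bsub>op_monoidal V\<^esub> f = f \<cdot>\<^bsub>V\<^esub> g"
  by (simp_all add: op_monoidal_def)

lemma ordmaps_Ide: "Ide Delta_plus m \<in> ordmaps"
  by (simp add: Delta_plus_simps ordmaps_iff)

lemma ordmaps_coface: "coface n i \<in> ordmaps"
  by (auto simp: coface_def ordmaps_iff)

lemma ordmaps_codegen: "i \<le> n \<Longrightarrow> codegen n i \<in> ordmaps"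
  by (auto simp: codegen_def ordmaps_iff)

lemma hom_coface: "coface n i \<in> hom Delta_plus n (n + 1)"
  using ordmaps_coface[of n i] by (simp add: hom_def Delta_plus_simps(2) coface_def Delta_plus_simps(3,4))

lemma hom_codegen: "i \<le> n \<Longrightarrow> codegen n i \<in> hom Delta_plus (n + 2) (n + 1)"
  using ordmaps_codegen[of i n] by (simp add: hom_def Delta_plus_simps(2) codegen_def Delta_plus_simps(3,4))

lemma sum_Ide_1:
  "i \<le> n \<Longrightarrow> ord_sum (coface n i) (Ide Delta_plus 1) = coface (n + 1) i"
  "i \<le> n \<Longrightarrow> ord_sum (codegen n i) (Ide Delta_plus 1) = codegen (n + 1) i"
  "ord_sum (Ide Delta_plus 1) (coface n i) = coface (n + 1) (i + 1)"
  "ord_sum (Ide Delta_plus 1) (codegen n i) = codegen (n + 1) (i + 1)"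
  by (auto simp: Delta_plus_simps ord_sum_def coface_def codegen_def fun_eq_iff)

lemma sum_Ide_generators:
  "ord_sum (Ide Delta_plus n) (coface 0 0) = coface n n"
  "ord_sum (Ide Delta_plus n) (codegen 0 0) = codegen n n"
  "ord_sum (coface 0 0) (Ide Delta_plus n) = coface n 0"
  "ord_sum (codegen 0 0) (Ide Delta_plus n) = codegen n 0"
  by (auto simp: Delta_plus_simps ord_sum_def coface_def codegen_def fun_eq_iff)

lemma lshift_1_decalage:
  "fobj (lshift Delta_plus_op 1 X) n = fobj X (n + 1)"
  "i \<le> n \<Longrightarrow> face (lshift Delta_plus_op 1 X) n i = face X (n + 1) i"
  "i \<le> n \<Longrightarrow> degen (lshift Delta_plus_op 1 X) n i = degen X (n + 1) i"
  by (simp_all add: lshift_def face_def degen_def op_monoidal_simps Delta_plus_simps(1,2,7,8)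
      ordmaps_Ide ordmaps_coface ordmaps_codegen sum_Ide_1[simplified])

lemma rshift_1_decalage:
  "fobj (rshift Delta_plus_op X 1) n = fobj X (n + 1)"
  "i \<le> n \<Longrightarrow> face (rshift Delta_plus_op X 1) n i = face X (n + 1) (i + 1)"
  "i \<le> n \<Longrightarrow> degen (rshift Delta_plus_op X 1) n i = degen X (n + 1) (i + 1)"
  by (simp_all add: rshift_def face_def degen_def op_monoidal_simps Delta_plus_simps(1,2,7,8)
      ordmaps_Ide ordmaps_coface ordmaps_codegen sum_Ide_1[simplified])

lemma lshift_1_counit_comult:
  assumes X: "is_functor Delta_plus_op Y X"
  shows "snd (snd (lshift_transf Delta_plus_op Y (coface 0 0) (Ide (fun_cat Delta_plus_op Y) X))) n
      = face X n n"
    and "snd (snd (lshift_transf Delta_plus_op Y (codegen 0 0) (Ide (fun_cat Delta_plus_op Y) X))) n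
      = degen X n n"
proof -
  interpret Y: category Y using X by (rule functor_in)
  have c: "coface n n \<in> hom Delta_plus_op (n + 1) n" "codegen n n \<in> hom Delta_plus_op (n + 1) (n + 2)"
    unfolding hom_op_monoidal by (simp_all only: hom_coface hom_codegen le_refl le0)
  have d: "Dom Delta_plus (coface 0 0) = 0" "Dom Delta_plus (codegen 0 0) = 2"
    by (simp_all add: coface_def codegen_def Delta_plus_simps)
  show "snd (snd (lshift_transf Delta_plus_op Y (coface 0 0) (Ide (fun_cat Delta_plus_op Y) X))) n
      = face X n n"
    "snd (snd (lshift_transf Delta_plus_op Y (codegen 0 0) (Ide (fun_cat Delta_plus_op Y) X))) n
      = degen X n n"
    using Y.Ide_Comp[OF functor_in(4)[OF X c(1)]] Y.Ide_Comp[OF functor_in(4)[OF X c(2)]]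
    by (simp_all add: lshift_transf_def fun_cat_simps face_def degen_def op_monoidal_simps d
        Delta_plus_simps(1,7,8) ordmaps_Ide ordmaps_coface ordmaps_codegen sum_Ide_generators)
qed

lemma rshift_1_counit_comult:
  assumes X: "is_functor Delta_plus_op Y X"
  shows "snd (snd (rshift_transf Delta_plus_op Y (Ide (fun_cat Delta_plus_op Y) X) (coface 0 0))) n
      = face X n 0"
    and "snd (snd (rshift_transf Delta_plus_op Y (Ide (fun_cat Delta_plus_op Y) X) (codegen 0 0))) n
      = degen X n 0"
proof -
  interpret Y: category Y using X by (rule functor_in)
  have c: "coface n 0 \<in> hom Delta_plus_op (n + 1) n" "codegen n 0 \<in> hom Delta_plus_op (n + 1) (n + 2)"
    unfolding hom_op_monoidal by (simp_all only: hom_coface hom_codegen le_refl le0)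
  have d: "Dom Delta_plus (coface 0 0) = 0" "Dom Delta_plus (codegen 0 0) = 2"
    by (simp_all add: coface_def codegen_def Delta_plus_simps)
  show "snd (snd (rshift_transf Delta_plus_op Y (Ide (fun_cat Delta_plus_op Y) X) (coface 0 0))) n
      = face X n 0"
    "snd (snd (rshift_transf Delta_plus_op Y (Ide (fun_cat Delta_plus_op Y) X) (codegen 0 0))) n
      = degen X n 0"
    using Y.Ide_Comp[OF functor_in(4)[OF X c(1)]] Y.Ide_Comp[OF functor_in(4)[OF X c(2)]]
    by (simp_all add: rshift_transf_def fun_cat_simps face_def degen_def op_monoidal_simps d
        Delta_plus_simps(1,7,8) ordmaps_Ide ordmaps_coface ordmaps_codegen sum_Ide_generators
        add.commute[of 2])
qed

end

theory Submission
  imports Defs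
begin

text \<open>
  Let \<open>(X, \<rho>)\<close> be an object of \<open>H\<^sup>0\<close>. Since both actions shift the argument of \<open>X\<close>, the component of
  \<open>\<rho>\<^sub>a : a \<rhd> X \<rightarrow> X \<lhd> a\<close> at \<open>b\<close> is an arrow \<open>r a b : X(b + a) \<rightarrow> X(a + b)\<close>. Sizes add up without regard to
  order, so \<open>r a b\<close> is an endomorphism of \<open>X(a + b)\<close>, to be thought of as rotating a row of \<open>a + b\<close>
  points by \<open>a\<close> places. The compatibility \<open>\<chi>\<close> is an identity, so the multiplicativity of \<open>\<rho>\<close> reads
  \<open>r (a + a') b = r a (a' + b) \<cdot> r a' (b + a)\<close>: three endomorphisms of the same object. Hence a
  rotation by \<open>a\<close> is the \<open>a\<close>-th power of the rotation by one, and \<open>\<rho>\<close> is determined by the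
  operators \<open>t n = r 1 n\<close> on \<open>X\<^sub>n = X(n + 1)\<close> (lemma \<open>rotation_family_eq_rotation\<close>).

  It remains to see which operators \<open>t\<close> arise. The two naturality conditions on \<open>r\<close>, restricted to
  generators of \<open>\<Delta>\<^sub>+\<close>, are exactly the duplicial identities:
  naturality of \<open>\<rho>\<^sub>1\<close> at cofaces and codegeneracies gives \<open>d\<^sub>i t = t d\<^sub>i\<^sub>-\<^sub>1\<close> and \<open>s\<^sub>j t = t s\<^sub>j\<^sub>-\<^sub>1\<close> for positive
  \<open>i\<close> and \<open>j\<close>, and naturality of \<open>\<rho>\<close> in \<open>a\<close> at the maps \<open>0 \<rightarrow> 1\<close> and \<open>2 \<rightarrow> 1\<close> gives \<open>d\<^sub>0 t = d\<^sub>n\<close> and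
  \<open>s\<^sub>0 t = t\<^sup>2 s\<^sub>n\<close>. Conversely these cases suffice. The ordinal \<open>1\<close> is a monoid in \<open>\<Delta>\<^sub>+\<close> whose
  structure maps \<open>0 \<rightarrow> 1\<close> and \<open>2 \<rightarrow> 1\<close> generate all maps under composition and ordinal sum
  (\<open>Delta_plus_monoidal_induct\<close>). Naturality in both variables together says that
  \<open>X(f \<oplus> g) \<cdot> t\<^sup>a = t\<^sup>a\<^sup>' \<cdot> X(g \<oplus> f)\<close> for \<open>f : a' \<rightarrow> a\<close> and all \<open>g\<close>, and the maps \<open>f\<close>
  with this property are closed under composition and under ordinal sum: \<open>f \<oplus> f'\<close> is moved past \<open>g\<close>
  by moving \<open>f'\<close> past \<open>g \<oplus> f\<close> and then \<open>f\<close> past \<open>f' \<oplus> g\<close> (lemma \<open>rotation_natural\<close>).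

  A morphism of \<open>H\<^sup>0\<close> is a transformation that commutes with all \<open>r a b\<close>, equivalently with their
  generators \<open>t n\<close> (lemma \<open>H0_mor_iff\<close>). So both categories consist of augmented simplicial objects
  with additional structure and have the same morphisms between corresponding objects, which makes
  the bijection of objects an isomorphism of categories.
\<close>

section \<open>Generation of the augmented simplicial category\<close>

lemma Ide_Delta_in: "Ide Delta_plus n \<in> hom Delta_plus n n"
  using category.Ide_in[OF category_Delta_plus, of n] by (simp add: Delta_plus_simps(1))

lemma const_ordmap_Suc:
  "(Suc m, 1, \<lambda>i \<in> {..<Suc m}. 0) =
    codegen 0 0 \<cdot>\<^bsub>Delta_plus\<^esub> ord_sum (m, 1, \<lambda>i \<in> {..<m}. 0) (Ide Delta_plus 1)"
  by (auto simp: codegen_def ord_sum_def Delta_plus_simps compose_def fun_eq_iff)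

lemma hom_Delta_plus_0: "f \<in> hom Delta_plus m 0 \<Longrightarrow> m = 0 \<and> f = Ide Delta_plus 0"
  by (cases m) (auto simp: hom_Delta_plus Delta_plus_simps)

text \<open>Cutting an order-preserving map at its last fibre: the fibre is a final segment of the domain
  because the map is monotone.\<close>

lemma hom_Delta_plus_Suc_decomp:
  assumes "f \<in> hom Delta_plus m (Suc n)"
  obtains k l g where "m = k + l" "g \<in> hom Delta_plus k n"
    "f = ord_sum g (l, 1, \<lambda>i \<in> {..<l}. 0)"
proof -
  obtain u where f: "f = (m, Suc n, u)" and u: "u \<in> extensional {..<m}"
    and less: "\<And>i. i < m \<Longrightarrow> u i < Suc n" and mono: "\<And>i j. i \<le> j \<Longrightarrow> j < m \<Longrightarrow> u i \<le> u j"
    using assms by (auto simp: hom_Delta_plus)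
  \<comment> \<open>the position where the last fibre starts, or \<open>m\<close> if that fibre is empty\<close>
  define k where "k = (LEAST k. m \<le> k \<or> n \<le> u k)"
  have km: "k \<le> m" unfolding k_def by (rule Least_le) simp
  have k: "m \<le> k \<or> n \<le> u k" unfolding k_def by (rule LeastI[of _ m]) simp
  have lt: "u i < n" if "i < k" for i
    using not_less_Least[of i "\<lambda>k. m \<le> k \<or> n \<le> u k"] that by (auto simp: k_def)
  have ge: "u i = n" if "k \<le> i" "i < m" for i
    using k mono[of k i] less[of i] that by auto
  have "(k, n, restrict u {..<k}) \<in> hom Delta_plus k n"
    using lt mono km by (auto simp: hom_Delta_plus)
  moreover have "f = ord_sum (k, n, restrict u {..<k}) (m - k, 1, \<lambda>i \<in> {..<m - k}. 0)"
    using km ge u by (auto simp: f ord_sum_def fun_eq_iff extensional_def)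
  ultimately show ?thesis using that[of k "m - k"] km by simp
qed

text \<open>Every order-preserving map is the ordinal sum of the maps from its fibres to \<open>1\<close>, and the
  map from an ordinal to \<open>1\<close> is an iterated multiplication of the monoid \<open>1\<close>. Inserting the unit
  of the monoid first makes \<open>const_ordmap_Suc\<close> valid for the empty ordinal too.\<close>

theorem Delta_plus_monoidal_induct [consumes 1, case_names Ide0 Ide1 unit mult Comp sum]:
  assumes f: "f \<in> hom Delta_plus m n"
    and Ide0: "P 0 0 (Ide Delta_plus 0)" and Ide1: "P 1 1 (Ide Delta_plus 1)"
    and unit: "P 0 1 (coface 0 0)" and mult: "P 2 1 (codegen 0 0)"
    and Comp: "\<And>k m n f g. \<lbrakk>f \<in> hom Delta_plus k m; g \<in> hom Delta_plus m n; P k m f; P m n g\<rbrakk>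
      \<Longrightarrow> P k n (g \<cdot>\<^bsub>Delta_plus\<^esub> f)"
    and sum: "\<And>m n m' n' f g. \<lbrakk>f \<in> hom Delta_plus m n; g \<in> hom Delta_plus m' n'; P m n f; P m' n' g\<rbrakk>
      \<Longrightarrow> P (m + m') (n + n') (ord_sum f g)"
  shows "P m n f"
proof -
  have const_in: "(l, 1, \<lambda>i \<in> {..<l}. 0) \<in> hom Delta_plus l 1" for l
    by (auto simp: hom_Delta_plus)
  have const: "P l 1 (l, 1, \<lambda>i \<in> {..<l}. 0)" for l
  proof (induction l)
    case 0
    show ?case using unit by (simp add: coface_def restrict_def)
  next
    case (Suc l)
    note 1 = Ide_Delta_in[of 1]
    have "codegen 0 0 \<in> hom Delta_plus (1 + 1) 1" using hom_codegen[of 0 0] by (simp add: numeral_2_eq_2)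
    moreover have "P (1 + 1) 1 (codegen 0 0)" using mult by (simp add: numeral_2_eq_2)
    ultimately have "P (l + 1) 1 (codegen 0 0 \<cdot>\<^bsub>Delta_plus\<^esub>
        ord_sum (l, 1, \<lambda>i \<in> {..<l}. 0) (Ide Delta_plus 1))"
      using Comp[OF ord_sum_in[OF const_in 1]] sum[OF const_in 1 Suc Ide1] by blast
    then show ?case unfolding const_ordmap_Suc by simp
  qed
  show ?thesis
    using f
  proof (induction n arbitrary: m f)
    case 0
    then show ?case using hom_Delta_plus_0 Ide0 by blast
  next
    case (Suc n)
    from hom_Delta_plus_Suc_decomp[OF Suc.prems] obtain k l g where
      "m = k + l" and g: "g \<in> hom Delta_plus k n" and "f = ord_sum g (l, 1, \<lambda>i \<in> {..<l}. 0)" .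
    then show ?case using sum[OF g const_in Suc.IH[OF g] const] by simp
  qed
qed

lemma ord_sum_Ide_generators:
  "ord_sum (Ide Delta_plus c) (ord_sum (coface 0 0) (Ide Delta_plus d)) = coface (c + d) c"
  "ord_sum (Ide Delta_plus c) (ord_sum (codegen 0 0) (Ide Delta_plus d)) = codegen (c + d) c"
  by (auto simp: Delta_plus_simps ord_sum_def coface_def codegen_def fun_eq_iff)

text \<open>The familiar generation by faces and degeneracies alone follows from the monoidal one by
  whiskering: a composite of sums of generators with identities replaces every ordinal sum.
  The property proved by monoidal induction is therefore required of \<open>c \<oplus> f \<oplus> d\<close> for all identities
  on ordinals \<open>c\<close> and \<open>d\<close>.\<close>

theorem Delta_plus_induct [consumes 1, case_names Ide coface codegen Comp]:
  assumes f: "f \<in> hom Delta_plus m n"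
    and Ide: "\<And>n. P n n (Ide Delta_plus n)"
    and coface: "\<And>n i. i \<le> n \<Longrightarrow> P n (n + 1) (coface n i)"
    and codegen: "\<And>n i. i \<le> n \<Longrightarrow> P (n + 2) (n + 1) (codegen n i)"
    and Comp: "\<And>k m n f g. \<lbrakk>f \<in> hom Delta_plus k m; g \<in> hom Delta_plus m n; P k m f; P m n g\<rbrakk>
      \<Longrightarrow> P k n (g \<cdot>\<^bsub>Delta_plus\<^esub> f)"
  shows "P m n f"
proof -
  interpret D: category Delta_plus by (rule category_Delta_plus)
  note i = Ide_Delta_in and s = ord_sum_in
  have "\<forall>c d. P (c + (m + d)) (c + (n + d))
      (ord_sum (Ide Delta_plus c) (ord_sum f (Ide Delta_plus d)))"
    using f
  proof (induction rule: Delta_plus_monoidal_induct)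
    case Ide0
    show ?case using Ide by (simp add: ord_sum_Ide)
  next
    case Ide1
    show ?case using Ide by (simp only: ord_sum_Ide) blast
  next
    case unit
    show ?case using coface[of _ "_ + _"] unfolding ord_sum_Ide_generators by (simp add: ac_simps)
  next
    case mult
    show ?case using codegen[of _ "_ + _"] unfolding ord_sum_Ide_generators by (simp add: ac_simps)
  next
    case (Comp k m n f g)
    show ?case
    proof (intro allI)
      fix c d
      have "ord_sum (Ide Delta_plus c) (ord_sum (g \<cdot>\<^bsub>Delta_plus\<^esub> f) (Ide Delta_plus d)) =
        ord_sum (Ide Delta_plus c) (ord_sum g (Ide Delta_plus d)) \<cdot>\<^bsub>Delta_plus\<^esub>
        ord_sum (Ide Delta_plus c) (ord_sum f (Ide Delta_plus d))"
        using ord_sum_Comp[OF i s[OF Comp(1) i] i s[OF Comp(2) i]]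
          ord_sum_Comp[OF Comp(1) i Comp(2) i] D.Comp_Ide[OF i] by simp
      then show "P (c + (k + d)) (c + (n + d))
          (ord_sum (Ide Delta_plus c) (ord_sum (g \<cdot>\<^bsub>Delta_plus\<^esub> f) (Ide Delta_plus d)))"
        using assms(5)[OF s[OF i s[OF Comp(1) i]] s[OF i s[OF Comp(2) i]]] Comp(3,4) by simp
    qed
  next
    case (sum m n m' n' f g)
    show ?case
    proof (intro allI)
      fix c d
      let ?f = "ord_sum (Ide Delta_plus c) (ord_sum f (Ide Delta_plus (n' + d)))"
      let ?g = "ord_sum (Ide Delta_plus (c + m)) (ord_sum g (Ide Delta_plus d))"
      \<comment> \<open>interchange: \<open>f \<oplus> g\<close> is \<open>g\<close> next to the source of \<open>f\<close>, followed by \<open>f\<close> next to the target of \<open>g\<close>\<close>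
      have gd: "ord_sum g (Ide Delta_plus d) \<in> hom Delta_plus (m' + d) (n' + d)"
        by (rule s[OF sum(2) i])
      have "ord_sum (Ide Delta_plus c) (ord_sum (ord_sum f g) (Ide Delta_plus d)) =
         ord_sum (ord_sum (Ide Delta_plus c) f) (ord_sum g (Ide Delta_plus d))"
        by (simp add: ord_sum_assoc)
      also have "\<dots> = ?f \<cdot>\<^bsub>Delta_plus\<^esub> ?g"
        using ord_sum_Comp[OF i gd s[OF i sum(1)] i] D.Comp_Ide[OF s[OF i sum(1)]] D.Ide_Comp[OF gd]
        by (simp add: ord_sum_assoc)
      finally show "P (c + (m + m' + d)) (c + (n + n' + d))
          (ord_sum (Ide Delta_plus c) (ord_sum (ord_sum f g) (Ide Delta_plus d)))"
        using assms(5)[of ?g "c + m + (m' + d)" "c + m + (n' + d)" ?f "c + (n + (n' + d))"]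
          s[OF i gd, of "c + m"] s[OF i s[OF sum(1) i], of c "n' + d"]
          sum(3)[rule_format, of c "n' + d"] sum(4)[rule_format, of "c + m" d]
        by (simp add: ac_simps)
    qed
  qed
  from this[rule_format, of 0 0] show ?thesis
    using f by (simp add: ord_sum_Unit hom_Delta_plus_ordmaps)
qed


section \<open>Powers of an endomorphism\<close>

primrec endo_pow :: "('o, 'm, 'z) category_scheme \<Rightarrow> 'o \<Rightarrow> 'm \<Rightarrow> nat \<Rightarrow> 'm" where
  "endo_pow C A f 0 = Ide C A"
| "endo_pow C A f (Suc k) = f \<cdot>\<^bsub>C\<^esub> endo_pow C A f k"

context category
begin

text \<open>The zeroth power is an identity whatever \<open>f\<close> is. There is no operator \<open>t\<close> on the object of the
  empty ordinal, where only the zeroth power is ever formed; therefore \<open>f\<close> has to be an endomorphism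
  of \<open>A\<close> only if the exponent is positive.\<close>

lemma endo_pow_in: "\<lbrakk>A \<in> Obj C; k \<noteq> 0 \<Longrightarrow> f \<in> hom C A A\<rbrakk> \<Longrightarrow> endo_pow C A f k \<in> hom C A A"
  by (induction k) (auto intro: Ide_in Comp_in)

lemma endo_pow_add:
  assumes A: "A \<in> Obj C" and f: "j + k \<noteq> 0 \<Longrightarrow> f \<in> hom C A A"
  shows "endo_pow C A f (j + k) = endo_pow C A f j \<cdot> endo_pow C A f k"
  using f
proof (induction j)
  case 0
  then show ?case using Ide_Comp[OF endo_pow_in[OF A]] by simp
next
  case (Suc j)
  then have f: "f \<in> hom C A A" by simp
  then show ?case
    using Suc.IH Comp_assoc[OF endo_pow_in[OF A] endo_pow_in[OF A] f] by simp
qed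

text \<open>Nearly all naturality arguments below reduce to this pasting of commuting squares; read
  backwards it also serves for squares stacked in the other direction.\<close>

lemma square_paste:
  assumes "p \<in> hom C A B" "p' \<in> hom C B D" "q \<in> hom C A' B'" "q' \<in> hom C B' D'"
    and "u \<in> hom C A A'" "v \<in> hom C B B'" "w \<in> hom C D D'"
    and "v \<cdot> p = q \<cdot> u" and "w \<cdot> p' = q' \<cdot> v"
  shows "w \<cdot> (p' \<cdot> p) = (q' \<cdot> q) \<cdot> u"
proof -
  have "w \<cdot> (p' \<cdot> p) = (w \<cdot> p') \<cdot> p" using assms Comp_assoc by metis
  also have "\<dots> = (q' \<cdot> v) \<cdot> p" by (simp add: assms)
  also have "\<dots> = q' \<cdot> (v \<cdot> p)" using assms Comp_assoc by metis
  also have "\<dots> = q' \<cdot> (q \<cdot> u)" by (simp add: assms)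
  also have "\<dots> = (q' \<cdot> q) \<cdot> u" using assms Comp_assoc by metis
  finally show ?thesis .
qed

lemma endo_pow_intertwine:
  assumes A: "A \<in> Obj C" "B \<in> Obj C" and p: "p \<in> hom C A B"
    and f: "k \<noteq> 0 \<Longrightarrow> f \<in> hom C A A" and g: "k \<noteq> 0 \<Longrightarrow> g \<in> hom C B B"
    and eq: "k \<noteq> 0 \<Longrightarrow> p \<cdot> f = g \<cdot> p"
  shows "p \<cdot> endo_pow C A f k = endo_pow C B g k \<cdot> p"
  using f g eq
proof (induction k)
  case 0
  show ?case by (simp add: Comp_Ide[OF p] Ide_Comp[OF p])
next
  case (Suc k)
  then have f: "f \<in> hom C A A" and g: "g \<in> hom C B B" by auto
  show ?case
    using square_paste[OF endo_pow_in[OF A(1) f] f endo_pow_in[OF A(2) g] g p p p] Suc f g by simp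
qed

end


section \<open>Duplicial objects and rotation families\<close>

text \<open>What an object of \<open>H\<^sup>0\<close> is in terms of the components \<open>r a b = (\<rho>\<^sub>a)\<^sub>b\<close>. The first naturality
  condition makes each \<open>\<rho>\<^sub>a\<close> an arrow of the functor category, the second is naturality of \<open>\<rho>\<close>.\<close>

definition rotation_family ::
  "('o, 'm, 'z) category_scheme \<Rightarrow> (nat, ordmap, 'o, 'm) ftor \<Rightarrow> (nat \<Rightarrow> nat \<Rightarrow> 'm) \<Rightarrow> bool"
where
  "rotation_family Y X r \<longleftrightarrow>
     (\<forall>a b. r a b \<in> hom Y (fobj X (a + b)) (fobj X (a + b))) \<and>
     (\<forall>a b b' g. g \<in> hom Delta_plus b' b \<longrightarrow>
        farr X (ord_sum (Ide Delta_plus a) g) \<cdot>\<^bsub>Y\<^esub> r a b =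
        r a b' \<cdot>\<^bsub>Y\<^esub> farr X (ord_sum g (Ide Delta_plus a))) \<and>
     (\<forall>a a' b f. f \<in> hom Delta_plus a' a \<longrightarrow>
        farr X (ord_sum f (Ide Delta_plus b)) \<cdot>\<^bsub>Y\<^esub> r a b =
        r a' b \<cdot>\<^bsub>Y\<^esub> farr X (ord_sum (Ide Delta_plus b) f)) \<and>
     (\<forall>b. r 0 b = Ide Y (fobj X b)) \<and>
     (\<forall>a a' b. r (a + a') b = r a (a' + b) \<cdot>\<^bsub>Y\<^esub> r a' (b + a))"

text \<open>\<open>t\<close> is indexed by the simplicial degree, so \<open>t (a + b - 1)\<close> is the operator on \<open>X(a + b)\<close>.
  For \<open>a = b = 0\<close> the truncated index is wrong, but then the exponent is zero.\<close>

definition rotation ::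
  "('o, 'm, 'z) category_scheme \<Rightarrow> (nat, ordmap, 'o, 'm) ftor \<Rightarrow> (nat \<Rightarrow> 'm) \<Rightarrow> nat \<Rightarrow> nat \<Rightarrow> 'm"
where
  "rotation Y X t a b = endo_pow Y (fobj X (a + b)) (t (a + b - 1)) a"

lemma rotation_0: "rotation Y X t 0 b = Ide Y (fobj X b)"
  by (simp add: rotation_def)

locale augmented_simplicial = category Y for Y (structure) +
  fixes X
  assumes X: "is_functor Delta_plus_op Y X"

lemma augmented_simplicialI: "is_functor Delta_plus_op Y X \<Longrightarrow> augmented_simplicial Y X"
  by (simp add: augmented_simplicial_def augmented_simplicial_axioms_def functor_in(2))

context augmented_simplicial
begin

lemma X_obj [simp]: "fobj X n \<in> Obj Y"
  using functor_in(3)[OF X, of n] by (simp add: op_monoidal_simps Delta_plus_simps)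

lemma X_arr: "f \<in> hom Delta_plus m n \<Longrightarrow> farr X f \<in> hom Y (fobj X n) (fobj X m)"
  using functor_in(4)[OF X, of f n m] by simp

lemma X_Ide: "farr X (Ide Delta_plus n) = Ide Y (fobj X n)"
  using functor_in(5)[OF X, of n] by (simp add: op_monoidal_simps Delta_plus_simps(1))

lemma X_Comp:
  "\<lbrakk>f \<in> hom Delta_plus k m; g \<in> hom Delta_plus m n\<rbrakk>
    \<Longrightarrow> farr X (g \<cdot>\<^bsub>Delta_plus\<^esub> f) = farr X f \<cdot> farr X g"
  using functor_in(6)[OF X, of g n m f k] by (simp add: op_monoidal_simps)

lemma X_sum: "\<lbrakk>f \<in> hom Delta_plus m n; g \<in> hom Delta_plus m' n'\<rbrakk>
    \<Longrightarrow> farr X (ord_sum f g) \<in> hom Y (fobj X (n + n')) (fobj X (m + m'))"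
  by (intro X_arr ord_sum_in)

lemma X_sum_Comp:
  "\<lbrakk>f \<in> hom Delta_plus k m; g \<in> hom Delta_plus m n; f' \<in> hom Delta_plus k' m'; g' \<in> hom Delta_plus m' n'\<rbrakk>
    \<Longrightarrow> farr X (ord_sum (g \<cdot>\<^bsub>Delta_plus\<^esub> f) (g' \<cdot>\<^bsub>Delta_plus\<^esub> f')) =
      farr X (ord_sum f f') \<cdot> farr X (ord_sum g g')"
  by (simp add: ord_sum_Comp X_Comp[OF ord_sum_in ord_sum_in])

lemma rotation_in:
  assumes "\<And>n. t n \<in> hom Y (fobj X (n + 1)) (fobj X (n + 1))"
  shows "rotation Y X t a b \<in> hom Y (fobj X (a + b)) (fobj X (a + b))"
  unfolding rotation_def using assms[of "a + b - 1"] by (intro endo_pow_in X_obj) simp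

lemma rotation_add:
  assumes "\<And>n. t n \<in> hom Y (fobj X (n + 1)) (fobj X (n + 1))"
  shows "rotation Y X t (a + a') b = rotation Y X t a (a' + b) \<cdot> rotation Y X t a' (b + a)"
proof -
  have "t (a + a' + b - 1) \<in> hom Y (fobj X (a + a' + b)) (fobj X (a + a' + b))" if "a + a' \<noteq> 0"
    using assms[of "a + a' + b - 1"] that by simp
  from endo_pow_add[OF X_obj this] show ?thesis
    by (simp add: rotation_def ac_simps)
qed

lemma rotation_1:
  assumes "\<And>n. t n \<in> hom Y (fobj X (n + 1)) (fobj X (n + 1))"
  shows "rotation Y X t 1 b = t b"
  using assms[of b] by (simp add: rotation_def Comp_Ide)

context
  fixes t
  assumes dup: "duplicial_obj Y X t"
begin

lemma t_in: "t n \<in> hom Y (fobj X (n + 1)) (fobj X (n + 1))"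
  using dup by (simp add: duplicial_obj_def)

text \<open>On generators this is the pair of duplicial identities with positive index, since
  \<open>1 \<oplus> f\<close> has the index of \<open>f\<close> raised by one and \<open>f \<oplus> 1\<close> keeps it.\<close>

lemma t_shift:
  assumes "f \<in> hom Delta_plus m n"
  shows "farr X (ord_sum (Ide Delta_plus 1) f) \<cdot> t n = t m \<cdot> farr X (ord_sum f (Ide Delta_plus 1))"
  using assms
proof (induction rule: Delta_plus_induct)
  case (Ide n)
  show ?case
    using Ide_Comp[OF t_in] Comp_Ide[OF t_in]
    by (simp add: ord_sum_Ide X_Ide add.commute[of 1] del: One_nat_def)
next
  case (coface n i)
  then have "face X (n + 1) (i + 1) \<cdot> t (n + 1) = t n \<cdot> face X (n + 1) i"
    using dup by (simp add: duplicial_obj_def)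
  then show ?case using coface by (simp add: sum_Ide_1 face_def del: One_nat_def)
next
  case (codegen n i)
  then have "degen X (n + 1) (i + 1) \<cdot> t (n + 1) = t (n + 2) \<cdot> degen X (n + 1) i"
    using dup by (simp add: duplicial_obj_def)
  then show ?case using codegen by (simp add: sum_Ide_1 degen_def del: One_nat_def)
next
  case (Comp k m n f g)
  note i = Ide_Delta_in[of 1]
  have t: "t l \<in> hom Y (fobj X (1 + l)) (fobj X (l + 1))" for l using t_in[of l] by (simp add: ac_simps)
  have "farr X (ord_sum (Ide Delta_plus 1) (g \<cdot>\<^bsub>Delta_plus\<^esub> f)) =
      farr X (ord_sum (Ide Delta_plus 1) f) \<cdot> farr X (ord_sum (Ide Delta_plus 1) g)"
    "farr X (ord_sum (g \<cdot>\<^bsub>Delta_plus\<^esub> f) (Ide Delta_plus 1)) =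
      farr X (ord_sum f (Ide Delta_plus 1)) \<cdot> farr X (ord_sum g (Ide Delta_plus 1))"
    using X_sum_Comp[OF i i Comp(1,2)] X_sum_Comp[OF Comp(1,2) i i]
      category.Comp_Ide[OF category_Delta_plus i] by simp_all
  then show ?case
    using square_paste[OF X_sum[OF Comp(2) i] X_sum[OF Comp(1) i] X_sum[OF i Comp(2)] X_sum[OF i Comp(1)],
      of "t n" "t m" "t k"] t_in Comp(3,4) by (simp add: ac_simps)
qed

text \<open>Monoidal induction on \<open>f\<close>, with \<open>g\<close> arbitrary. Quantifying over all \<open>g\<close>, and not only over
  identities, is what makes the property stable under ordinal sums of \<open>f\<close>. The identity of \<open>1\<close> is
  the case \<open>t_shift\<close>; the unit and the multiplication of the monoid \<open>1\<close> are the identities for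
  \<open>d\<^sub>0 t\<close> and \<open>s\<^sub>0 t\<close>.\<close>

lemma rotation_natural:
  assumes "f \<in> hom Delta_plus a' a" and "g \<in> hom Delta_plus b' b"
  shows "farr X (ord_sum f g) \<cdot> rotation Y X t a b = rotation Y X t a' b' \<cdot> farr X (ord_sum g f)"
proof -
  interpret D: category Delta_plus by (rule category_Delta_plus)
  note i = Ide_Delta_in
  let ?nat = "\<lambda>f a' a g b' b. farr X (ord_sum f g) \<cdot> rotation Y X t a b =
    rotation Y X t a' b' \<cdot> farr X (ord_sum g f)"
  have r_in: "rotation Y X t a b \<in> hom Y (fobj X m) (fobj X n)" if "m = a + b" "n = a + b" for a b m n
    using rotation_in[of t, OF t_in] that by simp
  have r1: "rotation Y X t 1 b = t b" for b by (rule rotation_1[OF t_in])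
  have paste: "?nat (f \<cdot>\<^bsub>Delta_plus\<^esub> f') a'' a (g \<cdot>\<^bsub>Delta_plus\<^esub> g') b'' b"
    if f: "f' \<in> hom Delta_plus a'' a'" "f \<in> hom Delta_plus a' a"
      and g: "g' \<in> hom Delta_plus b'' b'" "g \<in> hom Delta_plus b' b"
      and 1: "?nat f a' a g b' b" and 2: "?nat f' a'' a' g' b'' b'"
    for f f' g g' a a' a'' b b' b''
    unfolding X_sum_Comp[OF f g] X_sum_Comp[OF g f]
    by (rule square_paste[OF X_sum[OF g(2) f(2)] X_sum[OF g(1) f(1)] X_sum[OF f(2) g(2)]
          X_sum[OF f(1) g(1)] r_in r_in r_in 1[symmetric] 2[symmetric], symmetric]) simp_all
  have Ide_0: "?nat (Ide Delta_plus 0) 0 0 g b' b" if "g \<in> hom Delta_plus b' b" for g b' b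
    using that Comp_Ide[OF X_arr[OF that]] Ide_Comp[OF X_arr[OF that]]
    by (simp add: rotation_0 ord_sum_Unit hom_Delta_plus_ordmaps)
  have Ide_1: "?nat (Ide Delta_plus 1) 1 1 g b' b" if "g \<in> hom Delta_plus b' b" for g b' b
    using t_shift[OF that] by (simp only: r1)
  have sum': "?nat (ord_sum f f') (a' + c') (a + c) g b' b"
    if f: "f \<in> hom Delta_plus a' a" and f': "f' \<in> hom Delta_plus c' c" and g: "g \<in> hom Delta_plus b' b"
      and 1: "?nat f a' a (ord_sum f' g) (c' + b') (c + b)"
      and 2: "?nat f' c' c (ord_sum g f) (b' + a') (b + a)"
    for f f' g a a' b b' c c'
  proof -
    have x: "farr X (ord_sum g (ord_sum f f')) \<in> hom Y (fobj X (a + b + c)) (fobj X (a' + b' + c'))"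
      "farr X (ord_sum f' (ord_sum g f)) \<in> hom Y (fobj X (a + b + c)) (fobj X (a' + b' + c'))"
      "farr X (ord_sum f (ord_sum f' g)) \<in> hom Y (fobj X (a + b + c)) (fobj X (a' + b' + c'))"
      using X_sum[OF g ord_sum_in[OF f f']] X_sum[OF f' ord_sum_in[OF g f]]
        X_sum[OF f ord_sum_in[OF f' g]] by (simp_all add: ac_simps)
    show ?thesis
      unfolding rotation_add[of t, OF t_in] ord_sum_assoc
      by (rule square_paste[OF r_in r_in r_in r_in x 2[unfolded ord_sum_assoc] 1[unfolded ord_sum_assoc]])
        (simp_all add: ac_simps)
  qed
  have "\<forall>b' b h. h \<in> hom Delta_plus b' b \<longrightarrow> ?nat f a' a h b' b"
    using assms(1)
  proof (induction rule: Delta_plus_monoidal_induct)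
    case Ide0
    show ?case using Ide_0 by blast
  next
    case Ide1
    show ?case using Ide_1 by blast
  next
    case unit
    \<comment> \<open>split \<open>f \<oplus> g\<close> into \<open>f \<oplus> b\<close> after \<open>0 \<oplus> g\<close>, so that the identity for \<open>d\<^sub>0\<close> applies to the first\<close>
    have u: "coface 0 0 \<in> hom Delta_plus 0 1" using hom_coface[of 0 0] by simp
    have "?nat (coface 0 0) 0 1 (Ide Delta_plus b) b b" for b
      using dup Ide_Comp[OF X_arr[OF hom_coface]]
      by (simp add: duplicial_obj_def r1[simplified] rotation_0 sum_Ide_generators face_def)
    from paste[OF i u _ i this Ide_0] show ?case
      by (simp only: D.Comp_Ide[OF u]) (simp add: D.Ide_Comp)
  next
    case mult
    \<comment> \<open>the same splitting; the identity for \<open>s\<^sub>0\<close> brings the square of \<open>t\<close>, which moves past \<open>g\<close> in two steps\<close>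
    have u: "codegen 0 0 \<in> hom Delta_plus 2 1" using hom_codegen[of 0 0] by (simp add: numeral_2_eq_2)
    have "rotation Y X t 2 b = t (b + 1) \<cdot> t (b + 1)" for b
      using rotation_add[of t 1 1 b, OF t_in] r1 by (simp add: numeral_2_eq_2)
    moreover have "(t (b + 1) \<cdot> t (b + 1)) \<cdot> degen X b b = t (b + 1) \<cdot> t (b + 1) \<cdot> degen X b b" for b
      using X_arr[OF hom_codegen[of b b]] t_in[of "b + 1"] unfolding degen_def
      by (intro Comp_assoc) (simp_all add: numeral_2_eq_2)
    ultimately have 1: "?nat (codegen 0 0) 2 1 (Ide Delta_plus b) b b" for b
      using dup by (simp add: duplicial_obj_def r1[simplified] sum_Ide_generators degen_def)
    have "Ide Delta_plus 2 = ord_sum (Ide Delta_plus 1) (Ide Delta_plus 1)"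
      by (simp add: ord_sum_Ide numeral_2_eq_2)
    then have "?nat (Ide Delta_plus 2) 2 2 g b' b" if "g \<in> hom Delta_plus b' b" for g b' b
      using sum'[OF i i that Ide_1 Ide_1, OF ord_sum_in[OF i that] ord_sum_in[OF that i]]
      by (simp add: numeral_2_eq_2)
    from paste[OF i u _ i 1 this] show ?case
      by (simp only: D.Comp_Ide[OF u]) (simp add: D.Ide_Comp)
  next
    case (Comp k m n f g)
    show ?case
    proof (intro allI impI)
      fix b' b h assume h: "h \<in> hom Delta_plus b' b"
      show "?nat (g \<cdot>\<^bsub>Delta_plus\<^esub> f) k n h b' b"
        using paste[OF Comp(1,2) i h] Comp(3,4) h i by (simp add: D.Comp_Ide[OF h])
    qed
  next
    case (sum m n m' n' f g)
    show ?case
    proof (intro allI impI)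
      fix b' b h assume h: "h \<in> hom Delta_plus b' b"
      show "?nat (ord_sum f g) (m + m') (n + n') h b' b"
        using sum'[OF sum(1,2) h] sum(3,4) ord_sum_in[OF sum(2) h] ord_sum_in[OF h sum(1)] by blast
    qed
  qed
  then show ?thesis using assms(2) by blast
qed

end

lemma rotation_family_rotation:
  assumes dup: "duplicial_obj Y X t"
  shows "rotation_family Y X (rotation Y X t)"
  unfolding rotation_family_def
  using rotation_in[of t, OF t_in[OF dup]] rotation_natural[OF dup Ide_Delta_in]
    rotation_natural[OF dup _ Ide_Delta_in] rotation_0 rotation_add[of t, OF t_in[OF dup]]
  by blast

context
  fixes r
  assumes fam: "rotation_family Y X r"
begin

lemma family_in: "r a b \<in> hom Y (fobj X (a + b)) (fobj X (a + b))"
  using fam unfolding rotation_family_def by blast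

lemma family_natural_right:
  "g \<in> hom Delta_plus b' b \<Longrightarrow> farr X (ord_sum (Ide Delta_plus a) g) \<cdot> r a b =
    r a b' \<cdot> farr X (ord_sum g (Ide Delta_plus a))"
  using fam unfolding rotation_family_def by blast

lemma family_natural_left:
  "f \<in> hom Delta_plus a' a \<Longrightarrow> farr X (ord_sum f (Ide Delta_plus b)) \<cdot> r a b =
    r a' b \<cdot> farr X (ord_sum (Ide Delta_plus b) f)"
  using fam unfolding rotation_family_def by blast

lemma family_0: "r 0 b = Ide Y (fobj X b)"
  using fam unfolding rotation_family_def by blast

lemma family_add: "r (a + a') b = r a (a' + b) \<cdot> r a' (b + a)"
  using fam unfolding rotation_family_def by blast

text \<open>Multiplicativity with \<open>1 + a\<close> splits off one rotation by one place.\<close>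

lemma rotation_family_eq_rotation: "r a b = rotation Y X (r 1) a b"
proof (induction a arbitrary: b)
  case 0
  show ?case by (simp add: family_0 rotation_0)
next
  case (Suc a)
  have t: "r 1 n \<in> hom Y (fobj X (n + 1)) (fobj X (n + 1))" for n
    using family_in[of 1 n] by (simp add: add.commute)
  show ?case
    using family_add[of 1 a b] Suc[of "b + 1"] rotation_add[of "r 1" 1 a b, OF t]
      rotation_1[of "r 1" "a + b", OF t]
    by simp
qed

text \<open>Each duplicial identity is one naturality square: the positive indices come from whiskering by
  \<open>1\<close> on either side, the index zero from the unit and the multiplication of the monoid \<open>1\<close>. The
  square of \<open>t\<close> appears as \<open>r 2\<close>.\<close>

lemma duplicial_obj_family: "duplicial_obj Y X (r 1)"
proof -
  have t: "r 1 n \<in> hom Y (fobj X (n + 1)) (fobj X (n + 1))" for n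
    using family_in[of 1 n] by (simp add: add.commute)
  have face: "face X n i \<cdot> r 1 n = r 1 (n - 1) \<cdot> face X n (i - 1)" if i: "1 \<le> i" "i \<le> n" for n i
  proof -
    obtain m j where "n = Suc m" "i = Suc j" "j \<le> m"
      using i by (cases n; cases i) auto
    then show ?thesis
      using family_natural_right[OF hom_coface[of m j], of 1]
      by (simp add: face_def sum_Ide_1[simplified])
  qed
  have degen: "degen X n i \<cdot> r 1 n = r 1 (n + 1) \<cdot> degen X n (i - 1)" if i: "1 \<le> i" "i \<le> n" for n i
  proof -
    obtain m j where "n = Suc m" "i = Suc j" "j \<le> m"
      using i by (cases n; cases i) auto
    then show ?thesis
      using family_natural_right[OF hom_codegen[of j m], of 1]
      by (simp add: degen_def sum_Ide_1[simplified])
  qed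
  have face0: "face X n 0 \<cdot> r 1 n = face X n n" for n
    using family_natural_left[of "coface 0 0" 0 1 n] hom_coface[of 0 0] Ide_Comp[OF X_arr[OF hom_coface]]
    by (simp add: face_def sum_Ide_generators family_0)
  have degen0: "degen X n 0 \<cdot> r 1 n = r 1 (n + 1) \<cdot> r 1 (n + 1) \<cdot> degen X n n" for n
  proof -
    have "degen X n 0 \<cdot> r 1 n = r 2 n \<cdot> degen X n n"
      using family_natural_left[of "codegen 0 0" 2 1 n] hom_codegen[of 0 0]
      by (simp add: degen_def sum_Ide_generators numeral_2_eq_2)
    also have "r 2 n = r 1 (n + 1) \<cdot> r 1 (n + 1)"
      using family_add[of 1 1 n] by (simp add: numeral_2_eq_2)
    also have "(r 1 (n + 1) \<cdot> r 1 (n + 1)) \<cdot> degen X n n = r 1 (n + 1) \<cdot> r 1 (n + 1) \<cdot> degen X n n"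
      using X_arr[OF hom_codegen[of n n]] t[of "n + 1"] unfolding degen_def
      by (intro Comp_assoc) (simp_all add: numeral_2_eq_2)
    finally show ?thesis .
  qed
  show ?thesis
    unfolding duplicial_obj_def using X t face degen face0 degen0 by (simp add: fun_cat_simps)
qed

end

end


section \<open>Objects and morphisms of \<open>H\<^sup>0\<close> in components\<close>

abbreviation shift_bimodule_Delta ::
  "('o, 'm, 'z) category_scheme \<Rightarrow>
   (nat, ordmap, (nat, ordmap, 'o, 'm) ftor, (nat, ordmap, 'o, 'm) transf) bimodule" where
  "shift_bimodule_Delta Y \<equiv> shift_bimodule Delta_plus_op Y"

definition rotation_transf ::
  "(nat, ordmap, 'o, 'm) ftor \<Rightarrow> (nat \<Rightarrow> nat \<Rightarrow> 'm) \<Rightarrow> nat \<Rightarrow> (nat, ordmap, 'o, 'm) transf" where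
  "rotation_transf X r a = (lshift Delta_plus_op a X, rshift Delta_plus_op X a, r a)"

lemmas Delta_plus_op_simps = op_monoidal_simps Delta_plus_simps(1,2,7,9) restrict_UNIV

lemma tensor_Delta_plus:
  "\<lbrakk>f \<in> hom Delta_plus m n; g \<in> hom Delta_plus m' n'\<rbrakk> \<Longrightarrow> f \<otimes>\<^sub>a\<^bsub>Delta_plus\<^esub> g = ord_sum f g"
  by (simp add: Delta_plus_simps(8) hom_Delta_plus_ordmaps)

lemma strict_monoidal_Delta_plus_op: "strict_monoidal Delta_plus_op"
  by (intro strict_monoidal_op_monoidal strict_monoidal_Delta_plus)

lemma lact_Ide_component:
  assumes "natural_transformation Delta_plus_op Y X X' \<alpha>"
  shows "Ide Delta_plus a \<rhd>\<^sub>a\<^bsub>shift_bimodule_Delta Y\<^esub> (X, X', \<alpha>) =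
    (lshift Delta_plus_op a X, lshift Delta_plus_op a X', \<lambda>b. \<alpha> (b + a))"
proof -
  note a = natural_transformation_in[OF assms]
  interpret X: augmented_simplicial Y X
    using a(1) by (rule augmented_simplicialI)
  have "\<alpha> n \<in> hom Y (fobj X n) (fobj X' n)" for n using a(4)[of n] by (simp add: Delta_plus_op_simps)
  from X.Comp_Ide[OF this] show ?thesis
    using assms Ide_Delta_in[of a] lshift_transf_eq[of "Ide Delta_plus a" Delta_plus_op a a Y X X' \<alpha>]
    by (simp add: shift_bimodule_simps Delta_plus_op_simps Arr_fun_cat hom_Delta_plus_ordmaps
        tensor_Delta_plus[OF Ide_Delta_in Ide_Delta_in] ord_sum_Ide X.X_Ide homD[OF Ide_Delta_in])
qed

lemma ract_Ide_component:
  assumes "natural_transformation Delta_plus_op Y X X' \<alpha>"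
  shows "(X, X', \<alpha>) \<lhd>\<^sub>a\<^bsub>shift_bimodule_Delta Y\<^esub> Ide Delta_plus a =
    (rshift Delta_plus_op X a, rshift Delta_plus_op X' a, \<lambda>b. \<alpha> (a + b))"
proof -
  note a = natural_transformation_in[OF assms]
  interpret X: augmented_simplicial Y X
    using a(1) by (rule augmented_simplicialI)
  have "\<alpha> n \<in> hom Y (fobj X n) (fobj X' n)" for n using a(4)[of n] by (simp add: Delta_plus_op_simps)
  from X.Comp_Ide[OF this] show ?thesis
    using assms Ide_Delta_in[of a] rshift_transf_eq[of "Ide Delta_plus a" Delta_plus_op a a Y X X' \<alpha>]
    by (simp add: shift_bimodule_simps Delta_plus_op_simps Arr_fun_cat hom_Delta_plus_ordmaps
        tensor_Delta_plus[OF Ide_Delta_in Ide_Delta_in] ord_sum_Ide X.X_Ide homD[OF Ide_Delta_in])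
qed

lemma fun_cat_Delta_Comp:
  "(G, H, \<beta>) \<cdot>\<^bsub>fun_cat Delta_plus_op Y\<^esub> (F, G', \<alpha>) = (F, H, \<lambda>n. \<beta> n \<cdot>\<^bsub>Y\<^esub> \<alpha> n)"
  by (simp add: fun_cat_simps Delta_plus_op_simps)

context augmented_simplicial
begin

lemma lact_component:
  assumes f: "f \<in> hom Delta_plus a' a"
  shows "f \<rhd>\<^sub>a\<^bsub>shift_bimodule_Delta Y\<^esub> Ide (fun_cat Delta_plus_op Y) X =
    (lshift Delta_plus_op a X, lshift Delta_plus_op a' X, \<lambda>b. farr X (ord_sum (Ide Delta_plus b) f))"
proof -
  have "Ide (fun_cat Delta_plus_op Y) X \<in> Arr (fun_cat Delta_plus_op Y)"
    using natural_transformation_Ide[OF X] by (simp add: Arr_fun_cat fun_cat_simps)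
  then show ?thesis
    using f Ide_Comp[OF X_sum[OF Ide_Delta_in f]]
    by (simp add: shift_bimodule_simps Delta_plus_op_simps fun_cat_simps hom_Delta_plus_ordmaps
        lshift_transf_eq[of f Delta_plus_op a a'] homD[OF f] tensor_Delta_plus[OF Ide_Delta_in f])
qed

lemma ract_component:
  assumes f: "f \<in> hom Delta_plus a' a"
  shows "Ide (fun_cat Delta_plus_op Y) X \<lhd>\<^sub>a\<^bsub>shift_bimodule_Delta Y\<^esub> f =
    (rshift Delta_plus_op X a, rshift Delta_plus_op X a', \<lambda>b. farr X (ord_sum f (Ide Delta_plus b)))"
proof -
  have "Ide (fun_cat Delta_plus_op Y) X \<in> Arr (fun_cat Delta_plus_op Y)"
    using natural_transformation_Ide[OF X] by (simp add: Arr_fun_cat fun_cat_simps)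
  then show ?thesis
    using f Ide_Comp[OF X_sum[OF f Ide_Delta_in]]
    by (simp add: shift_bimodule_simps Delta_plus_op_simps fun_cat_simps hom_Delta_plus_ordmaps
        rshift_transf_eq[of f Delta_plus_op a a'] homD[OF f] tensor_Delta_plus[OF f Ide_Delta_in])
qed

text \<open>Source and target of \<open>\<rho>\<^sub>a\<close> evaluate at \<open>b\<close> to \<open>X(b + a)\<close> and \<open>X(a + b)\<close>, which are the same
  object; only their functoriality in \<open>b\<close> differs.\<close>

lemma shift_natural_iff:
  "natural_transformation Delta_plus_op Y (lshift Delta_plus_op a X) (rshift Delta_plus_op X a) s \<longleftrightarrow>
    (\<forall>b. s b \<in> hom Y (fobj X (a + b)) (fobj X (a + b))) \<and>
    (\<forall>b b' g. g \<in> hom Delta_plus b' b \<longrightarrow>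
        farr X (ord_sum (Ide Delta_plus a) g) \<cdot> s b = s b' \<cdot> farr X (ord_sum g (Ide Delta_plus a)))"
proof -
  have "is_functor Delta_plus_op Y (lshift Delta_plus_op a X)"
    "is_functor Delta_plus_op Y (rshift Delta_plus_op X a)"
    using is_functor_lshift[OF strict_monoidal_Delta_plus_op X, of a]
      is_functor_rshift[OF strict_monoidal_Delta_plus_op X, of a] by (simp_all add: Delta_plus_op_simps)
  moreover have "farr (lshift Delta_plus_op a X) g = farr X (ord_sum g (Ide Delta_plus a))"
    "farr (rshift Delta_plus_op X a) g = farr X (ord_sum (Ide Delta_plus a) g)"
    if g: "g \<in> hom Delta_plus b' b" for g b b'
    using g by (simp_all add: lshift_simps(2)[of g _ b b'] rshift_simps(2)[of g _ b b'] Delta_plus_op_simps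
        lshift_def rshift_def hom_Delta_plus_ordmaps
        tensor_Delta_plus[OF g Ide_Delta_in] tensor_Delta_plus[OF Ide_Delta_in g])
  ultimately show ?thesis
    unfolding natural_transformation_def
    by (auto simp: lshift_simps(1) rshift_simps(1) Delta_plus_op_simps add.commute[of _ a])
qed

text \<open>The actions are strict and \<open>\<chi>\<close> is an identity, so the sources and targets of both sides of every
  axiom agree as functors, and each axiom is equivalent to its components.\<close>

lemma H0_obj_rotation_transf_iff:
  "H0_obj Delta_plus_op (shift_bimodule_Delta Y) X (rotation_transf X r) \<longleftrightarrow> rotation_family Y X r"
proof -
  let ?F = "fun_cat Delta_plus_op Y" and ?M = "shift_bimodule_Delta Y"
  let ?l = "\<lambda>a X. lshift Delta_plus_op a X" and ?r = "\<lambda>X a. rshift Delta_plus_op X a"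
  note S = strict_monoidal_Delta_plus_op
  have XF: "X \<in> Obj ?F" using X by (simp add: fun_cat_simps)
  have lu: "?l 0 X = X" and ru: "?r X 0 = X"
    using lshift_Unit[OF S X] lshift_Unit[OF strict_monoidal_rev_monoidal[OF S], of Y X] X
    by (simp_all add: rshift_conv_lshift Delta_plus_op_simps)
  have lt: "?l (a + b) X = ?l a (?l b X)" and rt: "?r X (a + b) = ?r (?r X a) b" for a b
    using lshift_tensor[OF S X, of a b] lshift_tensor[OF strict_monoidal_rev_monoidal[OF S], of Y X b a] X
    by (simp_all add: rshift_conv_lshift Delta_plus_op_simps)
  have lF: "is_functor Delta_plus_op Y (?l a X)" and rF: "is_functor Delta_plus_op Y (?r X a)" for a
    using is_functor_lshift[OF S X, of a] is_functor_rshift[OF S X, of a]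
    by (simp_all add: Delta_plus_op_simps)
  let ?nat = "\<forall>a. natural_transformation Delta_plus_op Y (?l a X) (?r X a) (r a)"
  have 1: "(\<forall>A \<in> Obj Delta_plus_op.
      rotation_transf X r A \<in> hom (Under ?M) (A \<rhd>\<^sub>o\<^bsub>?M\<^esub> X) (X \<lhd>\<^sub>o\<^bsub>?M\<^esub> A)) \<longleftrightarrow> ?nat"
    using XF by (simp add: shift_bimodule_simps Delta_plus_op_simps hom_fun_cat rotation_transf_def)
  have 2: "(Ide ?F X \<lhd>\<^sub>a\<^bsub>?M\<^esub> f) \<cdot>\<^bsub>?F\<^esub> rotation_transf X r a =
      rotation_transf X r a' \<cdot>\<^bsub>?F\<^esub> (f \<rhd>\<^sub>a\<^bsub>?M\<^esub> Ide ?F X) \<longleftrightarrow>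
    (\<forall>b. farr X (ord_sum f (Ide Delta_plus b)) \<cdot> r a b = r a' b \<cdot> farr X (ord_sum (Ide Delta_plus b) f))"
    if "f \<in> hom Delta_plus a' a" for f a a'
    by (simp add: lact_component[OF that] ract_component[OF that] rotation_transf_def fun_cat_Delta_Comp
        fun_eq_iff)
  have 3: "rotation_transf X r 0 = Ide ?F X \<longleftrightarrow> (\<forall>b. r 0 b = Ide Y (fobj X b))"
    by (simp add: rotation_transf_def lu ru fun_cat_simps fun_eq_iff Delta_plus_op_simps)
  have 4: "rotation_transf X r (a + a') =
      (rotation_transf X r a \<lhd>\<^sub>a\<^bsub>?M\<^esub> Ide Delta_plus a') \<cdot>\<^bsub>?F\<^esub> Chi ?M a X a' \<cdot>\<^bsub>?F\<^esub>
        (Ide Delta_plus a \<rhd>\<^sub>a\<^bsub>?M\<^esub> rotation_transf X r a') \<longleftrightarrow>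
    (\<forall>b. r (a + a') b = r a (a' + b) \<cdot> r a' (b + a))" if n: ?nat for a a'
  proof -
    have "r a' n \<in> hom Y (fobj X (n + a')) (fobj X (a' + n))" for n
      using n by (simp add: shift_natural_iff add.commute)
    from Ide_Comp[OF this]
    have "Ide Y (fobj X (a' + (b + a))) \<cdot> r a' (b + a) = r a' (b + a)" for b .
    then show ?thesis
      using n[rule_format, of a] n[rule_format, of a']
      by (simp add: rotation_transf_def ract_Ide_component lact_Ide_component shift_bimodule_simps
          fun_cat_simps fun_cat_Delta_Comp fun_eq_iff lt rt lshift_simps(1) rshift_simps(1)
          Delta_plus_op_simps)
  qed
  show ?thesis (is "?L \<longleftrightarrow> _")
  proof
    assume L: ?L
    then have n: ?nat using 1 by (simp add: H0_obj_def)
    show "rotation_family Y X r"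
      unfolding rotation_family_def
    proof (intro conjI allI impI, goal_cases)
      case (1 a b) show ?case using n by (simp add: shift_natural_iff)
    next
      case (2 a b b' g) then show ?case using n unfolding shift_natural_iff by blast
    next
      case (3 a a' b f)
      then show ?case
        using L 2[OF 3] unfolding H0_obj_def shift_bimodule_simps(1) hom_op_monoidal by blast
    next
      case (4 b) show ?case using L 3 by (simp add: H0_obj_def Delta_plus_op_simps shift_bimodule_simps(1))
    next
      case (5 a a' b)
      show ?case using L 4[OF n, of a a'] by (simp add: H0_obj_def Delta_plus_op_simps shift_bimodule_simps(1))
    qed
  next
    assume fam: "rotation_family Y X r"
    then have n: ?nat unfolding rotation_family_def shift_natural_iff by blast
    show ?L
      unfolding H0_obj_def 1
    proof (intro conjI allI impI ballI, goal_cases)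
      case 1 show ?case using XF by (simp add: shift_bimodule_simps)
    next
      case 2 show ?case by (simp add: Delta_plus_op_simps)
    next
      case (3 a) show ?case using n by blast
    next
      case (4 a a' f)
      then have "f \<in> hom Delta_plus a' a" by simp
      from 2[OF this] family_natural_left[OF fam this] show ?case by (simp add: shift_bimodule_simps(1))
    next
      case 5
      show ?case using 3 family_0[OF fam] by (simp add: Delta_plus_op_simps shift_bimodule_simps(1))
    next
      case (6 a a')
      show ?case
        using 4[OF n, of a a'] family_add[OF fam] by (simp add: Delta_plus_op_simps shift_bimodule_simps(1))
    qed
  qed
qed

end

section \<open>Categories of structured objects\<close>

text \<open>Objects of \<open>U\<close> with a structure in \<open>'s\<close>; \<open>S P Q f\<close> says that \<open>f\<close> preserves the structure. Both
  categories of the theorem have this form over the category of augmented simplicial objects.\<close>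

definition structured_cat ::
  "('o, 'm, 'z) category_scheme \<Rightarrow> ('o \<times> 's) set \<Rightarrow> ('o \<times> 's \<Rightarrow> 'o \<times> 's \<Rightarrow> 'm \<Rightarrow> bool) \<Rightarrow>
   ('o \<times> 's, ('o \<times> 's) \<times> ('o \<times> 's) \<times> 'm) category"
where
  "structured_cat U Ob S =
     \<lparr>Obj = Ob,
      Arr = {(P, Q, f). P \<in> Ob \<and> Q \<in> Ob \<and> f \<in> hom U (fst P) (fst Q) \<and> S P Q f},
      Dom = (\<lambda>(P, Q, f). P),
      Cod = (\<lambda>(P, Q, f). Q),
      Ide = (\<lambda>P. (P, P, Ide U (fst P))),
      Comp = (\<lambda>(Q, R, g) (P, Q', f). (P, R, g \<cdot>\<^bsub>U\<^esub> f))\<rparr>"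

lemma structured_cat_simps:
  "Obj (structured_cat U Ob S) = Ob"
  "Arr (structured_cat U Ob S) = {(P, Q, f). P \<in> Ob \<and> Q \<in> Ob \<and> f \<in> hom U (fst P) (fst Q) \<and> S P Q f}"
  "Dom (structured_cat U Ob S) (P, Q, f) = P"
  "Cod (structured_cat U Ob S) (P, Q, f) = Q"
  "Ide (structured_cat U Ob S) P = (P, P, Ide U (fst P))"
  "(Q, R, g) \<cdot>\<^bsub>structured_cat U Ob S\<^esub> (P, Q', f) = (P, R, g \<cdot>\<^bsub>U\<^esub> f)"
  by (simp_all add: structured_cat_def)

lemma hom_structured_cat:
  "p \<in> hom (structured_cat U Ob S) P Q \<longleftrightarrow>
    (\<exists>f. p = (P, Q, f) \<and> P \<in> Ob \<and> Q \<in> Ob \<and> f \<in> hom U (fst P) (fst Q) \<and> S P Q f)"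
  by (auto simp: hom_def structured_cat_def)

lemma category_structured_cat:
  assumes U: "category U" and Ob: "\<And>P. P \<in> Ob \<Longrightarrow> fst P \<in> Obj U"
    and Ide: "\<And>P. P \<in> Ob \<Longrightarrow> S P P (Ide U (fst P))"
    and Comp: "\<And>P Q R f g. \<lbrakk>P \<in> Ob; Q \<in> Ob; R \<in> Ob; f \<in> hom U (fst P) (fst Q); S P Q f;
      g \<in> hom U (fst Q) (fst R); S Q R g\<rbrakk> \<Longrightarrow> S P R (g \<cdot>\<^bsub>U\<^esub> f)"
  shows "category (structured_cat U Ob S)"
proof -
  interpret U: category U by (rule U)
  show ?thesis
    by unfold_locales
      (auto simp: hom_structured_cat structured_cat_simps U.Ide_in Ob Ide
        intro: U.Comp_in Comp U.Comp_Ide U.Ide_Comp U.Comp_assoc)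
qed

lemma is_functor_structured_cat:
  assumes C: "category (structured_cat U Ob S)" and D: "category (structured_cat U Ob' S')"
    and \<phi>: "\<And>P. P \<in> Ob \<Longrightarrow> \<phi> P \<in> Ob' \<and> fst (\<phi> P) = fst P"
    and S: "\<And>P Q f. \<lbrakk>P \<in> Ob; Q \<in> Ob; f \<in> hom U (fst P) (fst Q); S P Q f\<rbrakk> \<Longrightarrow> S' (\<phi> P) (\<phi> Q) f"
  shows "is_functor (structured_cat U Ob S) (structured_cat U Ob' S')
    \<lparr>fobj = restrict \<phi> Ob,
     farr = restrict (\<lambda>(P, Q, f). (\<phi> P, \<phi> Q, f)) (Arr (structured_cat U Ob S))\<rparr>"
proof -
  interpret C: category "structured_cat U Ob S" by (rule C)
  have Arr: "P \<in> Ob \<Longrightarrow> Q \<in> Ob \<Longrightarrow> f \<in> hom U (fst P) (fst Q) \<Longrightarrow> S P Q f \<Longrightarrow>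
    (P, Q, f) \<in> Arr (structured_cat U Ob S)" for P Q f
    by (simp add: structured_cat_simps)
  have Ide: "(P, P, Ide U (fst P)) \<in> Arr (structured_cat U Ob S)" if "P \<in> Ob" for P
    using C.Ide_in[of P] that homD by (fastforce simp: structured_cat_simps)
  have Comp: "(P, R, g \<cdot>\<^bsub>U\<^esub> f) \<in> Arr (structured_cat U Ob S)"
    if "(P, Q, f) \<in> Arr (structured_cat U Ob S)" "(Q, R, g) \<in> Arr (structured_cat U Ob S)" for P Q R f g
    using C.Comp_in[of "(P, Q, f)" P Q "(Q, R, g)" R] that
    by (simp add: hom_structured_cat structured_cat_simps)
  show ?thesis
    unfolding is_functor_def
  proof (intro conjI allI impI ballI, goal_cases)
    case 3 show ?case using \<phi> by (auto simp: structured_cat_simps)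
  next
    case (5 P Q p)
    then obtain f where "p = (P, Q, f)" "P \<in> Ob" "Q \<in> Ob" "f \<in> hom U (fst P) (fst Q)" "S P Q f"
      by (auto simp: hom_structured_cat)
    then show ?case using \<phi> S[of P Q f] by (simp add: hom_structured_cat Arr)
  next
    case (6 P)
    then show ?case using \<phi> Ide by (simp add: structured_cat_simps(1,5))
  next
    case (7 P Q R p q)
    then obtain f g where e: "p = (P, Q, f)" "q = (Q, R, g)"
      and A: "(P, Q, f) \<in> Arr (structured_cat U Ob S)" "(Q, R, g) \<in> Arr (structured_cat U Ob S)"
      by (auto simp: hom_structured_cat Arr)
    show ?case unfolding e structured_cat_simps(6) using A Comp[OF A] by (simp add: structured_cat_simps(6))
  qed (simp_all add: C D)
qed

text \<open>Two categories of structured objects over the same \<open>U\<close> are isomorphic as soon as their objects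
  correspond over \<open>U\<close> and the same arrows of \<open>U\<close> preserve the two structures. Closure under
  identities and composition has to be checked on one side only and is transported to the other.\<close>

theorem isomorphic_structured_cats:
  assumes U: "category U" and Ob: "\<And>P. P \<in> Ob' \<Longrightarrow> fst P \<in> Obj U"
    and \<phi>: "\<And>P. P \<in> Ob \<Longrightarrow> \<phi> P \<in> Ob' \<and> fst (\<phi> P) = fst P \<and> \<psi> (\<phi> P) = P"
    and \<psi>: "\<And>P. P \<in> Ob' \<Longrightarrow> \<psi> P \<in> Ob \<and> fst (\<psi> P) = fst P \<and> \<phi> (\<psi> P) = P"
    and S: "\<And>P Q f. \<lbrakk>P \<in> Ob; Q \<in> Ob; f \<in> hom U (fst P) (fst Q)\<rbrakk> \<Longrightarrow> S P Q f \<longleftrightarrow> S' (\<phi> P) (\<phi> Q) f"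
    and Ide: "\<And>P. P \<in> Ob' \<Longrightarrow> S' P P (Ide U (fst P))"
    and Comp: "\<And>P Q R f g. \<lbrakk>P \<in> Ob'; Q \<in> Ob'; R \<in> Ob'; f \<in> hom U (fst P) (fst Q); S' P Q f;
      g \<in> hom U (fst Q) (fst R); S' Q R g\<rbrakk> \<Longrightarrow> S' P R (g \<cdot>\<^bsub>U\<^esub> f)"
  shows "isomorphic_categories (structured_cat U Ob S) (structured_cat U Ob' S')"
proof -
  interpret U: category U by (rule U)
  let ?C = "structured_cat U Ob S" and ?D = "structured_cat U Ob' S'"
  let ?F = "\<lparr>fobj = restrict \<phi> Ob, farr = restrict (\<lambda>(P, Q, f). (\<phi> P, \<phi> Q, f)) (Arr ?C)\<rparr>"
  let ?G = "\<lparr>fobj = restrict \<psi> Ob', farr = restrict (\<lambda>(P, Q, f). (\<psi> P, \<psi> Q, f)) (Arr ?D)\<rparr>"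
  have S': "S (\<psi> P) (\<psi> Q) f \<longleftrightarrow> S' P Q f" if "P \<in> Ob'" "Q \<in> Ob'" "f \<in> hom U (fst P) (fst Q)" for P Q f
    using S[of "\<psi> P" "\<psi> Q" f] \<psi>[OF that(1)] \<psi>[OF that(2)] that(3) by simp
  have D: "category ?D" using U Ob Ide Comp by (rule category_structured_cat)
  have C: "category ?C"
  proof (rule category_structured_cat[OF U])
    show "P \<in> Ob \<Longrightarrow> fst P \<in> Obj U" "P \<in> Ob \<Longrightarrow> S P P (Ide U (fst P))" for P
      using \<phi>[of P] Ob[of "\<phi> P"] Ide[of "\<phi> P"] S[of P P] U.Ide_in by auto
  next
    fix P Q R f g
    assume a: "P \<in> Ob" "Q \<in> Ob" "R \<in> Ob" "f \<in> hom U (fst P) (fst Q)" "S P Q f"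
      "g \<in> hom U (fst Q) (fst R)" "S Q R g"
    then show "S P R (g \<cdot>\<^bsub>U\<^esub> f)"
      using Comp[of "\<phi> P" "\<phi> Q" "\<phi> R" f g] \<phi> S U.Comp_in[OF a(4,6)] by simp
  qed
  have "is_functor ?C ?D ?F" using C D \<phi> S by (intro is_functor_structured_cat) auto
  moreover have "is_functor ?D ?C ?G" using C D \<psi> S' by (intro is_functor_structured_cat) auto
  moreover have "comp_functor ?C ?G ?F = id_functor ?C"
    using \<phi> S by (auto simp: comp_functor_def id_functor_def structured_cat_simps(1,2) fun_eq_iff)
  moreover have "comp_functor ?D ?F ?G = id_functor ?D"
    using \<psi> S' by (auto simp: comp_functor_def id_functor_def structured_cat_simps(1,2) fun_eq_iff)
  ultimately show ?thesis unfolding isomorphic_categories_def by blast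
qed

section \<open>The isomorphism\<close>

lemma H0_structured_cat:
  "H0 V M = structured_cat (Under M) {(X, \<rho>). H0_obj V M X \<rho>}
    (\<lambda>(X, \<rho>) (X', \<rho>') f. \<forall>A \<in> Obj V. (f \<lhd>\<^sub>a\<^bsub>M\<^esub> Ide V A) \<cdot>\<^bsub>Under M\<^esub> \<rho> A =
      \<rho>' A \<cdot>\<^bsub>Under M\<^esub> (Ide V A \<rhd>\<^sub>a\<^bsub>M\<^esub> f))"
  by (auto simp: H0_def structured_cat_def)

lemma duplicial_cat_structured_cat:
  "duplicial_cat Y = structured_cat (fun_cat Delta_plus_op Y) {(X, t). duplicial_obj Y X t}
    (\<lambda>(X, t) (X', t') f. \<forall>n. snd (snd f) (n + 1) \<cdot>\<^bsub>Y\<^esub> t n = t' n \<cdot>\<^bsub>Y\<^esub> snd (snd f) (n + 1))"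
  by (auto simp: duplicial_cat_def structured_cat_def)

text \<open>The bijection on objects: \<open>\<rho>\<close> consists of the powers of a duplicial operator, recovered as
  \<open>\<rho>\<^sub>1\<close>.\<close>

lemma H0_obj_iff:
  "H0_obj Delta_plus_op (shift_bimodule_Delta Y) X \<rho> \<longleftrightarrow>
    (\<exists>t. duplicial_obj Y X t \<and> \<rho> = rotation_transf X (rotation Y X t))"
proof
  assume H: "H0_obj Delta_plus_op (shift_bimodule_Delta Y) X \<rho>"
  then have XF: "X \<in> Obj (fun_cat Delta_plus_op Y)" by (simp add: H0_obj_def shift_bimodule_simps)
  then interpret X: augmented_simplicial Y X by (simp add: fun_cat_simps augmented_simplicialI)
  have "\<rho> a \<in> hom (fun_cat Delta_plus_op Y) (lshift Delta_plus_op a X) (rshift Delta_plus_op X a)" for a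
    using H XF by (simp add: H0_obj_def shift_bimodule_simps Delta_plus_op_simps)
  then have "\<exists>s. \<rho> a = (lshift Delta_plus_op a X, rshift Delta_plus_op X a, s)" for a
    unfolding hom_fun_cat by blast
  then obtain r where "\<And>a. \<rho> a = (lshift Delta_plus_op a X, rshift Delta_plus_op X a, r a)" by metis
  then have \<rho>: "\<rho> = rotation_transf X r" by (simp add: rotation_transf_def fun_eq_iff)
  have fam: "rotation_family Y X r"
    using H unfolding \<rho> X.H0_obj_rotation_transf_iff .
  have "\<rho> = rotation_transf X (rotation Y X (r 1))"
    unfolding \<rho> rotation_transf_def using X.rotation_family_eq_rotation[OF fam] by blast
  then show "\<exists>t. duplicial_obj Y X t \<and> \<rho> = rotation_transf X (rotation Y X t)"
    using X.duplicial_obj_family[OF fam] by blast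
next
  assume "\<exists>t. duplicial_obj Y X t \<and> \<rho> = rotation_transf X (rotation Y X t)"
  then obtain t where t: "duplicial_obj Y X t" and \<rho>: "\<rho> = rotation_transf X (rotation Y X t)" by blast
  interpret X: augmented_simplicial Y X
    using t by (simp add: duplicial_obj_def fun_cat_simps augmented_simplicialI)
  show "H0_obj Delta_plus_op (shift_bimodule_Delta Y) X \<rho>"
    unfolding \<rho> X.H0_obj_rotation_transf_iff by (rule X.rotation_family_rotation[OF t])
qed

text \<open>Commuting with \<open>t\<close> is the case of rotations by one place, and it implies commuting with all
  powers of \<open>t\<close>.\<close>

lemma H0_mor_iff:
  assumes t: "duplicial_obj Y X t" and t': "duplicial_obj Y X' t'"
    and f: "f \<in> hom (fun_cat Delta_plus_op Y) X X'"
  shows "(\<forall>A \<in> Obj Delta_plus_op.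
      (f \<lhd>\<^sub>a\<^bsub>shift_bimodule_Delta Y\<^esub> Ide Delta_plus_op A) \<cdot>\<^bsub>fun_cat Delta_plus_op Y\<^esub>
        rotation_transf X (rotation Y X t) A =
      rotation_transf X' (rotation Y X' t') A \<cdot>\<^bsub>fun_cat Delta_plus_op Y\<^esub>
        (Ide Delta_plus_op A \<rhd>\<^sub>a\<^bsub>shift_bimodule_Delta Y\<^esub> f)) \<longleftrightarrow>
    (\<forall>n. snd (snd f) (n + 1) \<cdot>\<^bsub>Y\<^esub> t n = t' n \<cdot>\<^bsub>Y\<^esub> snd (snd f) (n + 1))"
proof -
  interpret X: augmented_simplicial Y X
    using t by (simp add: duplicial_obj_def fun_cat_simps augmented_simplicialI)
  interpret X': augmented_simplicial Y X'
    using t' by (simp add: duplicial_obj_def fun_cat_simps augmented_simplicialI)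
  obtain \<alpha> where e: "f = (X, X', \<alpha>)" and \<alpha>: "natural_transformation Delta_plus_op Y X X' \<alpha>"
    using f by (auto simp: hom_fun_cat)
  have a: "\<alpha> n \<in> hom Y (fobj X n) (fobj X' n)" for n
    using natural_transformation_in(4)[OF \<alpha>, of n] by (simp add: Delta_plus_op_simps)
  have "(\<forall>a b. \<alpha> (a + b) \<cdot>\<^bsub>Y\<^esub> rotation Y X t a b = rotation Y X' t' a b \<cdot>\<^bsub>Y\<^esub> \<alpha> (b + a)) \<longleftrightarrow>
    (\<forall>n. \<alpha> (n + 1) \<cdot>\<^bsub>Y\<^esub> t n = t' n \<cdot>\<^bsub>Y\<^esub> \<alpha> (n + 1))" (is "?L \<longleftrightarrow> ?R")
  proof
    assume L: ?L
    show ?R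
      using L[rule_format, of 1] X.rotation_1[of t, OF X.t_in[OF t]] X'.rotation_1[of t', OF X'.t_in[OF t']]
      by (simp add: add.commute[of 1] del: One_nat_def)
  next
    assume R: ?R
    show ?L
    proof (intro allI)
      fix a b
      show "\<alpha> (a + b) \<cdot>\<^bsub>Y\<^esub> rotation Y X t a b = rotation Y X' t' a b \<cdot>\<^bsub>Y\<^esub> \<alpha> (b + a)"
        unfolding rotation_def add.commute[of b a]
        using X.t_in[OF t, of "a + b - 1"] X'.t_in[OF t', of "a + b - 1"] R[rule_format, of "a + b - 1"]
        by (intro X.endo_pow_intertwine X.X_obj X'.X_obj a) simp_all
    qed
  qed
  then show ?thesis
    by (simp add: e ract_Ide_component[OF \<alpha>] lact_Ide_component[OF \<alpha>] rotation_transf_def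
        fun_cat_Delta_Comp Delta_plus_op_simps fun_eq_iff)
qed

theorem theorem5p3p8:
  fixes Y :: "('o, 'm) category"
  assumes "category Y"
  shows "isomorphic_categories
    (H0 Delta_plus_op (shift_bimodule Delta_plus_op Y))
    (duplicial_cat Y)"
  unfolding H0_structured_cat duplicial_cat_structured_cat shift_bimodule_simps(1)
proof (rule isomorphic_structured_cats[where
      \<phi> = "\<lambda>(X, \<rho>). (X, snd (snd (\<rho> 1)))" and
      \<psi> = "\<lambda>(X, t). (X, rotation_transf X (rotation Y X t))"], goal_cases)
  let ?F = "fun_cat Delta_plus_op Y"
  interpret Y: category Y by (rule assms)
  have t_in: "t n \<in> hom Y (fobj X (n + 1)) (fobj X (n + 1))" if "duplicial_obj Y X t" for X t n
    using that by (simp add: duplicial_obj_def)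
  have rotation_1: "snd (snd (rotation_transf X (rotation Y X t) 1)) = t" if "duplicial_obj Y X t" for X t
  proof -
    interpret X: augmented_simplicial Y X
      using that by (simp add: duplicial_obj_def fun_cat_simps augmented_simplicialI)
    show ?thesis using X.rotation_1[of t, OF t_in[OF that]] by (simp add: rotation_transf_def fun_eq_iff)
  qed
  have comp: "snd (snd f) n \<in> hom Y (fobj X n) (fobj X' n)" if "f \<in> hom ?F X X'" for f X X' n
    using that natural_transformation_in(4)[of Delta_plus_op Y X X' _ n]
    by (auto simp: hom_fun_cat Delta_plus_op_simps)
  {
    case 1
    show ?case
      by (intro category_fun_cat category_op_monoidal category_Delta_plus assms)
  next
    case (2 P) then show ?case by (auto simp: duplicial_obj_def)
  next
    case (3 P) then show ?case by (auto simp: H0_obj_iff rotation_1 simp del: One_nat_def)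
  next
    case (4 P) then show ?case by (auto simp: H0_obj_iff rotation_1 simp del: One_nat_def)
  next
    case (5 P Q f)
    then obtain X t X' t' where
      e: "P = (X, rotation_transf X (rotation Y X t))" "Q = (X', rotation_transf X' (rotation Y X' t'))"
      and t: "duplicial_obj Y X t" "duplicial_obj Y X' t'"
      by (auto simp: H0_obj_iff)
    show ?case
      using H0_mor_iff[OF t] 5(3) unfolding e prod.case rotation_1[OF t(1)] rotation_1[OF t(2)] by simp
  next
    case (6 P)
    then show ?case
      using Y.Comp_Ide[OF t_in] Y.Ide_Comp[OF t_in] by (auto simp: fun_cat_simps Delta_plus_op_simps)
  next
    case (7 P Q R f g)
    obtain X t X' t' X'' t'' where e: "P = (X, t)" "Q = (X', t')" "R = (X'', t'')"
      by (cases P; cases Q; cases R)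
    obtain \<alpha> \<beta> where fg: "f = (X, X', \<alpha>)" "g = (X', X'', \<beta>)"
      using 7 by (auto simp: e hom_fun_cat)
    have dup: "duplicial_obj Y X t" "duplicial_obj Y X' t'" "duplicial_obj Y X'' t''"
      and f: "f \<in> hom ?F X X'" and g: "g \<in> hom ?F X' X''"
      and sq: "t' n \<cdot>\<^bsub>Y\<^esub> \<alpha> (n + 1) = \<alpha> (n + 1) \<cdot>\<^bsub>Y\<^esub> t n"
        "t'' n \<cdot>\<^bsub>Y\<^esub> \<beta> (n + 1) = \<beta> (n + 1) \<cdot>\<^bsub>Y\<^esub> t' n" for n
      using 7 by (simp_all add: e fg)
    have \<alpha>: "\<alpha> n \<in> hom Y (fobj X n) (fobj X' n)" and \<beta>: "\<beta> n \<in> hom Y (fobj X' n) (fobj X'' n)" for n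
      using comp[OF f] comp[OF g] by (simp_all add: fg)
    have "(\<beta> (n + 1) \<cdot>\<^bsub>Y\<^esub> \<alpha> (n + 1)) \<cdot>\<^bsub>Y\<^esub> t n = t'' n \<cdot>\<^bsub>Y\<^esub> (\<beta> (n + 1) \<cdot>\<^bsub>Y\<^esub> \<alpha> (n + 1))" for n
      by (rule Y.square_paste[OF \<alpha> \<beta> \<alpha> \<beta> dup[THEN t_in] sq, symmetric])
    then show ?case by (simp add: e fg fun_cat_Delta_Comp)
  }
qed

end
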